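(* For each odd prime $q$ and every integer $n\ge1$, the number $M_q(n)$ of index $n$ subgroups $\Delta$ in $\mathfrak{H}(q)$ with the property that $\mu(\Delta)=0$ is even.
   Context: For an odd prime $q$, $\mathfrak{H}(q)=\langle x,y\mid x^2=y^q=1\rangle\cong C_2*C_q$ is the Hecke group attached to $q$. By Kurosh's subgroup theorem every finite-index subgroup $\Delta\le\mathfrak{H}(q)$ is of the form $\Delta\cong C_2^{*\lambda(\Delta)}*C_q^{*\mu(\Delta)}*F_{\nu(\Delta)}$ with uniquely determined non-negative integers $\lambda(\Delta),\mu(\Delta),\nu(\Delta)$, where $G^{*r}$ is the free product of $r$ copies of $G$ and $F_r$ is the free group of rank $r$. Thus $\mu(\Delta)=0$ means that $\Delta$ is a free product of copies of $C_2$ and of $C_\infty$. *)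

theory Defs
  imports "HOL-Algebra.Elementary_Groups" "HOL-Computational_Algebra.Primes"
begin

text \<open>
  The free product of a family of groups, in its normal form: an element is an alternating word of
  syllables \<open>(i, g)\<close>, where \<open>g\<close> is a nontrivial element of the \<open>i\<close>-th factor and
  neighbouring syllables come from different factors.
\<close>

definition reduced_words :: "'i set \<Rightarrow> ('i \<Rightarrow> ('a, 'b) monoid_scheme) \<Rightarrow> ('i \<times> 'a) list set" where
  "reduced_words I G =
     {w. (\<forall>(i, g) \<in> set w. i \<in> I \<and> g \<in> carrier (G i) \<and> g \<noteq> \<one>\<^bsub>G i\<^esub>) \<and> distinct_adj (map fst w)}"

fun prepend_syllable ::
  "('i \<Rightarrow> ('a, 'b) monoid_scheme) \<Rightarrow> 'i \<times> 'a \<Rightarrow> ('i \<times> 'a) list \<Rightarrow> ('i \<times> 'a) list" where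
  "prepend_syllable G (i, g) [] = [(i, g)]"
| "prepend_syllable G (i, g) ((j, h) # w) =
     (if i = j
      then if g \<otimes>\<^bsub>G i\<^esub> h = \<one>\<^bsub>G i\<^esub> then w else (i, g \<otimes>\<^bsub>G i\<^esub> h) # w
      else (i, g) # (j, h) # w)"

definition free_product ::
  "'i set \<Rightarrow> ('i \<Rightarrow> ('a, 'b) monoid_scheme) \<Rightarrow> ('i \<times> 'a) list monoid" where
  "free_product I G =
     \<lparr>carrier = reduced_words I G,
      monoid.mult = (\<lambda>u v. foldr (prepend_syllable G) u v),
      one = []\<rparr>"

text \<open>
  The free product of cyclic groups of the listed orders; an entry \<open>0\<close> stands for an infinite
  cyclic factor, since \<^term>\<open>integer_mod_group 0\<close> is \<^term>\<open>integer_group\<close>.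
\<close>

definition free_product_cyclic :: "nat list \<Rightarrow> (nat \<times> int) list monoid" where
  "free_product_cyclic ms = free_product {..<length ms} (\<lambda>i. integer_mod_group (ms ! i))"

definition hecke_group :: "nat \<Rightarrow> (nat \<times> int) list monoid" where
  "hecke_group q = free_product_cyclic [2, q]"

text \<open>
  \<open>kurosh_type q D l m v\<close> says that \<open>D\<close> is the free product of \<open>l\<close> copies of \<open>C\<^sub>2\<close>,
  \<open>m\<close> copies of \<open>C\<^sub>q\<close> and a free group of rank \<open>v\<close> (that is, \<open>v\<close> copies of the
  infinite cyclic group). For a finite-index subgroup \<open>D\<close> of \<open>hecke_group q\<close> the triple
  \<open>(l, m, v)\<close> exists and is unique, so that \<open>\<mu>(D) = 0\<close> is \<open>\<exists>l v. kurosh_type q D l 0 v\<close>.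
\<close>

definition kurosh_type :: "nat \<Rightarrow> ('a, 'b) monoid_scheme \<Rightarrow> nat \<Rightarrow> nat \<Rightarrow> nat \<Rightarrow> bool" where
  "kurosh_type q D l m v \<longleftrightarrow>
     D \<cong> free_product_cyclic (replicate l 2 @ replicate m q @ replicate v 0)"

definition num_mu_zero_subgroups :: "nat \<Rightarrow> nat \<Rightarrow> nat" where
  "num_mu_zero_subgroups q n =
     card {D. subgroup D (hecke_group q) \<and> card (rcosets\<^bsub>hecke_group q\<^esub> D) = n \<and>
           (\<exists>l v. kurosh_type q ((hecke_group q)\<lparr>carrier := D\<rparr>) l 0 v)}"


lemma Nil_in_reduced_words [simp]: "[] \<in> reduced_words I G"
  by (simp add: reduced_words_def)

lemma Cons_in_reduced_words:
  "(i, g) # w \<in> reduced_words I G \<longleftrightarrow>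
     i \<in> I \<and> g \<in> carrier (G i) \<and> g \<noteq> \<one>\<^bsub>G i\<^esub> \<and> w \<in> reduced_words I G \<and>
     (w = [] \<or> fst (hd w) \<noteq> i)"
  by (cases w) (auto simp: reduced_words_def)

lemma prepend_syllable_reduced:
  assumes "\<And>i. i \<in> I \<Longrightarrow> group (G i)"
    and "i \<in> I" "g \<in> carrier (G i)" "g \<noteq> \<one>\<^bsub>G i\<^esub>" "w \<in> reduced_words I G"
  shows "prepend_syllable G (i, g) w \<in> reduced_words I G"
proof -
  interpret group "G i" using assms by blast
  show ?thesis
    using assms(2-) by (cases w) (auto simp: Cons_in_reduced_words)
qed

lemma prepend_syllable_twice:
  assumes "\<And>i. i \<in> I \<Longrightarrow> group (G i)"
    and "i \<in> I" "g \<in> carrier (G i)" "g \<noteq> \<one>\<^bsub>G i\<^esub>" "h \<in> carrier (G i)" "h \<noteq> \<one>\<^bsub>G i\<^esub>"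
    and "w \<in> reduced_words I G"
  shows "prepend_syllable G (i, g) (prepend_syllable G (i, h) w) =
    (if g \<otimes>\<^bsub>G i\<^esub> h = \<one>\<^bsub>G i\<^esub> then w else prepend_syllable G (i, g \<otimes>\<^bsub>G i\<^esub> h) w)"
proof -
  interpret group "G i" using assms by blast
  have no_merge: "prepend_syllable G (i, k) w' = (i, k) # w'" if "w' = [] \<or> fst (hd w') \<noteq> i" for k w'
    using that by (cases w') auto
  show ?thesis
  proof (cases "w = [] \<or> fst (hd w) \<noteq> i")
    case True
    then show ?thesis by (simp add: no_merge)
  next
    case False
    then obtain k w' where w: "w = (i, k) # w'" by (cases w) auto
    with assms have k: "k \<in> carrier (G i)" "k \<noteq> \<one>\<^bsub>G i\<^esub>" "w' = [] \<or> fst (hd w') \<noteq> i"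
      by (auto simp: Cons_in_reduced_words)
    have 1: "g \<otimes>\<^bsub>G i\<^esub> (h \<otimes>\<^bsub>G i\<^esub> k) = (g \<otimes>\<^bsub>G i\<^esub> h) \<otimes>\<^bsub>G i\<^esub> k"
      using assms k by (simp add: m_assoc)
    have 2: "g \<otimes>\<^bsub>G i\<^esub> h \<otimes>\<^bsub>G i\<^esub> k = g" if "h \<otimes>\<^bsub>G i\<^esub> k = \<one>\<^bsub>G i\<^esub>"
      using assms k that by (simp flip: 1)
    have 3: "g \<otimes>\<^bsub>G i\<^esub> h \<otimes>\<^bsub>G i\<^esub> k = k" if "g \<otimes>\<^bsub>G i\<^esub> h = \<one>\<^bsub>G i\<^esub>"
      using k that by simp
    have 4: "g = k" if "g \<otimes>\<^bsub>G i\<^esub> h = \<one>\<^bsub>G i\<^esub>" "h \<otimes>\<^bsub>G i\<^esub> k = \<one>\<^bsub>G i\<^esub>"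
      using 2 3 that by simp
    show ?thesis
      using assms(2-) k by (auto simp: w 1 2 3 no_merge dest: 4)
  qed
qed

lemma foldr_prepend_reduced:
  assumes "\<And>i. i \<in> I \<Longrightarrow> group (G i)" "u \<in> reduced_words I G" "v \<in> reduced_words I G"
  shows "foldr (prepend_syllable G) u v \<in> reduced_words I G"
  using assms(2)
proof (induction u)
  case (Cons a u)
  then show ?case
    by (cases a) (auto simp: Cons_in_reduced_words intro!: prepend_syllable_reduced assms(1))
qed (use assms(3) in simp)

lemma foldr_prepend_Cons:
  assumes "\<And>i. i \<in> I \<Longrightarrow> group (G i)"
    and "i \<in> I" "g \<in> carrier (G i)" "g \<noteq> \<one>\<^bsub>G i\<^esub>" "u \<in> reduced_words I G" "v \<in> reduced_words I G"
  shows "foldr (prepend_syllable G) (prepend_syllable G (i, g) u) v =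
         prepend_syllable G (i, g) (foldr (prepend_syllable G) u v)"
proof (cases u)
  case (Cons a w)
  obtain j h where a: "a = (j, h)" by (cases a)
  have h: "j \<in> I" "h \<in> carrier (G j)" "h \<noteq> \<one>\<^bsub>G j\<^esub>" "w \<in> reduced_words I G"
    using assms(5) by (auto simp: Cons a Cons_in_reduced_words)
  note red = foldr_prepend_reduced[OF assms(1) h(4) assms(6)]
  show ?thesis
  proof (cases "i = j")
    case True
    with h prepend_syllable_twice[OF assms(1), where i = i and g = g and h = h
        and w = "foldr (prepend_syllable G) w v"]
    show ?thesis using assms red by (simp add: Cons a)
  qed (simp add: Cons a)
qed simp

lemma foldr_prepend_assoc:
  assumes "\<And>i. i \<in> I \<Longrightarrow> group (G i)"
    and "u \<in> reduced_words I G" "v \<in> reduced_words I G" "w \<in> reduced_words I G"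
  shows "foldr (prepend_syllable G) (foldr (prepend_syllable G) u v) w =
         foldr (prepend_syllable G) u (foldr (prepend_syllable G) v w)"
  using assms(2)
proof (induction u)
  case (Cons a u)
  obtain i g where a: "a = (i, g)" by (cases a)
  with Cons.prems have g: "i \<in> I" "g \<in> carrier (G i)" "g \<noteq> \<one>\<^bsub>G i\<^esub>" "u \<in> reduced_words I G"
    by (auto simp: Cons_in_reduced_words)
  with foldr_prepend_Cons[OF assms(1) g(1-3) foldr_prepend_reduced[OF assms(1) g(4) assms(3)] assms(4)]
  show ?case by (simp add: a Cons.IH)
qed simp

lemma foldr_prepend_Nil:
  "u \<in> reduced_words I G \<Longrightarrow> foldr (prepend_syllable G) u [] = u"
proof (induction u)
  case (Cons a u)
  then show ?case
    by (cases a; cases u) (auto simp: Cons_in_reduced_words)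
qed simp

theorem group_free_product:
  assumes "\<And>i. i \<in> I \<Longrightarrow> group (G i)"
  shows "group (free_product I G)"
proof (rule groupI)
  fix x assume "x \<in> carrier (free_product I G)"
  then have "x \<in> reduced_words I G" by (simp add: free_product_def)
  then have "\<exists>y\<in>reduced_words I G. foldr (prepend_syllable G) y x = []"
  proof (induction x)
    case (Cons a x)
    obtain i g where a: "a = (i, g)" by (cases a)
    with Cons.prems have g: "i \<in> I" "g \<in> carrier (G i)" "g \<noteq> \<one>\<^bsub>G i\<^esub>" "x \<in> reduced_words I G"
      by (auto simp: Cons_in_reduced_words)
    interpret group "G i" using assms g by blast
    obtain y where y: "y \<in> reduced_words I G" "foldr (prepend_syllable G) y x = []"
      using Cons.IH g by blast
    define b where "b = [(i, inv\<^bsub>G i\<^esub> g)]"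
    have b: "b \<in> reduced_words I G"
      using g by (simp add: b_def Cons_in_reduced_words)
    have "foldr (prepend_syllable G) (foldr (prepend_syllable G) y b) (a # x) =
          foldr (prepend_syllable G) y (foldr (prepend_syllable G) b (a # x))"
      using foldr_prepend_assoc[OF assms y(1) b Cons.prems] by simp
    also have "\<dots> = []" using y g by (simp add: b_def a)
    finally show ?case
      using foldr_prepend_reduced[OF assms y(1) b] by blast
  qed (auto intro: bexI[of _ "[]"])
  then show "\<exists>y\<in>carrier (free_product I G). y \<otimes>\<^bsub>free_product I G\<^esub> x = \<one>\<^bsub>free_product I G\<^esub>"
    by (simp add: free_product_def)
qed (auto simp: free_product_def intro: foldr_prepend_reduced foldr_prepend_assoc assms)

lemma group_hecke_group: "group (hecke_group q)"
  unfolding hecke_group_def free_product_cyclic_def by (rule group_free_product) simp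

end

theory Submission
  imports Defs "HOL-Combinatorics.Permutations"
begin

text \<open>
  Let \<open>x\<close> and \<open>y\<close> be the generators of orders \<open>2\<close> and \<open>q\<close>. The proof translates subgroups into
  combinatorial data that are rigid enough to be altered by hand.

  For a finite-index subgroup \<open>D\<close>, the condition \<open>\<mu>(D) = 0\<close> means that \<open>y\<close> acts on the cosets of \<open>D\<close>
  with all cycles of length \<open>q\<close>. If \<open>\<mu>(D) = 0\<close>, then \<open>D\<close> has no elements of order \<open>q\<close>, by the torsion
  theorem for free products (\<open>torsion_free_product_cyclic\<close>), so no nontrivial power of \<open>y\<close> fixes a
  coset. Conversely, if all cycles have length \<open>q\<close>, a spanning tree of the graph with the \<open>y\<close>-cycles
  as vertices and the \<open>x\<close>-orbits as edges gives free generators of \<open>D\<close>, of orders \<open>2\<close> and infinity: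
  this is the case of Kurosh's theorem that is needed here (\<open>kurosh_type_stab\<close>).

  Breadth-first search from the coset \<open>D\<close> labels the cosets by \<open>0, \<dots>, n - 1\<close> in a canonical way, with
  \<open>y\<close> acting by the standard cycles \<open>(0 \<dots> q-1) (q \<dots> 2q-1) \<dots>\<close>. So only the involution by which \<open>x\<close>
  acts varies, and the subgroups with \<open>\<mu>(D) = 0\<close> correspond bijectively to those involutions for
  which the given labelling is the one found by the search (\<open>canonical_involution_exists\<close>, \<open>canonical_involution_unique\<close>).

  The set of these canonical involutions has even cardinality
  (\<open>even_card_canonical_involutions\<close>). Once the search has discovered the last cycle, the values of
  the involution that have not been inspected yet are unrestricted. As \<open>q \<ge> 3\<close>, the last cycle has
  two points besides its entry, and with the transposition \<open>\<tau>\<close> of these two points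
  \<open>X \<mapsto> X \<tau>\<close> (if \<open>X\<close> and \<open>\<tau>\<close> commute) or \<open>X \<mapsto> \<tau> X \<tau>\<close> (otherwise) is an involution without
  fixed points on the canonical involutions.
\<close>

section \<open>Actions of free products\<close>

lemma foldr_step_closed:
  assumes "\<And>i g s. i \<in> I \<Longrightarrow> g \<in> carrier (G i) \<Longrightarrow> s \<in> S \<Longrightarrow> step (i, g) s \<in> S"
    and "w \<in> reduced_words I G" "s \<in> S"
  shows "foldr step w s \<in> S"
  using assms(2)
proof (induction w)
  case (Cons a w)
  then show ?case
    by (cases a) (auto simp: Cons_in_reduced_words intro!: assms(1))
qed (use assms(3) in simp)

text \<open>
  Actions of the factors of a free product on a common set extend to an action of the free product,
  a word acting syllable by syllable.
\<close>

lemma foldr_step_prepend: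
  assumes grp: "\<And>i. i \<in> I \<Longrightarrow> group (G i)"
    and closed: "\<And>i g s. i \<in> I \<Longrightarrow> g \<in> carrier (G i) \<Longrightarrow> s \<in> S \<Longrightarrow> step (i, g) s \<in> S"
    and one: "\<And>i s. i \<in> I \<Longrightarrow> s \<in> S \<Longrightarrow> step (i, \<one>\<^bsub>G i\<^esub>) s = s"
    and mult: "\<And>i g h s. i \<in> I \<Longrightarrow> g \<in> carrier (G i) \<Longrightarrow> h \<in> carrier (G i) \<Longrightarrow> s \<in> S \<Longrightarrow>
                 step (i, g \<otimes>\<^bsub>G i\<^esub> h) s = step (i, g) (step (i, h) s)"
    and "i \<in> I" "g \<in> carrier (G i)" "w \<in> reduced_words I G" "s \<in> S"
  shows "foldr step (prepend_syllable G (i, g) w) s = step (i, g) (foldr step w s)"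
proof (cases w)
  case (Cons a v)
  obtain j h where a: "a = (j, h)" by (cases a)
  have v: "j \<in> I" "h \<in> carrier (G j)" "v \<in> reduced_words I G"
    using assms(7) by (auto simp: Cons a Cons_in_reduced_words)
  have vs: "foldr step v s \<in> S"
    using foldr_step_closed[of I G S step, OF closed v(3) assms(8)] .
  show ?thesis
    using mult[of i g h "foldr step v s"] one[of i "foldr step v s"] v vs assms(5,6)
    by (auto simp: Cons a)
qed simp

section \<open>Free products of cyclic groups\<close>

lemma group_free_product_cyclic [simp]: "group (free_product_cyclic ms)"
  unfolding free_product_cyclic_def by (rule group_free_product) simp

lemma Nil_in_free_product_cyclic [simp]: "[] \<in> carrier (free_product_cyclic ms)"
  by (simp add: free_product_cyclic_def free_product_def)

lemma one_free_product_cyclic [simp]: "\<one>\<^bsub>free_product_cyclic ms\<^esub> = []"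
  by (simp add: free_product_cyclic_def free_product_def)

lemma Cons_in_free_product_cyclic:
  "(i, k) # w \<in> carrier (free_product_cyclic ms) \<longleftrightarrow>
     i < length ms \<and> k \<in> carrier (integer_mod_group (ms ! i)) \<and> k \<noteq> 0 \<and>
     w \<in> carrier (free_product_cyclic ms) \<and> (w = [] \<or> fst (hd w) \<noteq> i)"
  by (auto simp: free_product_cyclic_def free_product_def Cons_in_reduced_words)

lemma append_in_free_product_cyclicD:
  assumes "u @ v \<in> carrier (free_product_cyclic ms)"
  shows "u \<in> carrier (free_product_cyclic ms)" "v \<in> carrier (free_product_cyclic ms)"
    and "u = [] \<or> v = [] \<or> fst (last u) \<noteq> fst (hd v)"
  using assms
  by (auto simp: free_product_cyclic_def free_product_def reduced_words_def distinct_adj_append_iff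
      last_map hd_map)

lemma mult_free_product_cyclic_Cons:
  "(a # u) \<otimes>\<^bsub>free_product_cyclic ms\<^esub> v =
     prepend_syllable (\<lambda>i. integer_mod_group (ms ! i)) a (u \<otimes>\<^bsub>free_product_cyclic ms\<^esub> v)"
  by (simp add: free_product_cyclic_def free_product_def)

lemma mult_free_product_cyclic_Nil [simp]: "[] \<otimes>\<^bsub>free_product_cyclic ms\<^esub> v = v"
  by (simp add: free_product_cyclic_def free_product_def)

lemma mult_free_product_cyclic_append:
  assumes "u = [] \<or> v = [] \<or> fst (last u) \<noteq> fst (hd v)" "u \<in> carrier (free_product_cyclic ms)"
  shows "u \<otimes>\<^bsub>free_product_cyclic ms\<^esub> v = u @ v"
  using assms
proof (induction u)
  case (Cons a u)
  obtain i k where a: "a = (i, k)" by (cases a)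
  have u: "u \<in> carrier (free_product_cyclic ms)" "u = [] \<or> fst (hd u) \<noteq> i"
    using Cons.prems by (auto simp: a Cons_in_free_product_cyclic)
  have "u \<otimes>\<^bsub>free_product_cyclic ms\<^esub> v = u @ v"
    by (rule Cons.IH) (use Cons.prems u in \<open>auto split: if_splits\<close>)
  moreover have "u @ v = [] \<or> fst (hd (u @ v)) \<noteq> i"
    using u Cons.prems by (auto simp: a hd_append)
  ultimately show ?case
    by (cases "u @ v") (auto simp: mult_free_product_cyclic_Cons a)
qed simp

lemma syllable_mult:
  "[(i, k)] \<otimes>\<^bsub>free_product_cyclic ms\<^esub> [(i, k')] =
     (if (k + k') mod int (ms ! i) = 0 then [] else [(i, (k + k') mod int (ms ! i))])"
  by (simp add: mult_free_product_cyclic_Cons)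

lemma syllable_mult_Cons:
  assumes "(i, k) # w \<in> carrier (free_product_cyclic ms)"
  shows "[(i, k)] \<otimes>\<^bsub>free_product_cyclic ms\<^esub> w = (i, k) # w"
  using assms by (subst mult_free_product_cyclic_append) (auto simp: Cons_in_free_product_cyclic)

lemma free_product_cyclic_induct [consumes 1, case_names Nil syllable]:
  assumes "w \<in> carrier (free_product_cyclic ms)" and "Q []"
    and "\<And>i k w. [(i, k)] \<in> carrier (free_product_cyclic ms) \<Longrightarrow>
           w \<in> carrier (free_product_cyclic ms) \<Longrightarrow> Q w \<Longrightarrow> Q ([(i, k)] \<otimes>\<^bsub>free_product_cyclic ms\<^esub> w)"
  shows "Q w"
  using assms(1)
proof (induction w)
  case (Cons a w)
  obtain i k where a: "a = (i, k)" by (cases a)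
  have "Q ([(i, k)] \<otimes>\<^bsub>free_product_cyclic ms\<^esub> w)"
    by (rule assms(3)) (use Cons in \<open>auto simp: a Cons_in_free_product_cyclic\<close>)
  then show ?case
    using Cons.prems by (simp add: a syllable_mult_Cons)
qed (use assms(2) in simp)

text \<open>A subgroup that contains the canonical generator of every cyclic factor is the whole group.\<close>

lemma free_product_cyclic_generated:
  assumes sub: "subgroup K (free_product_cyclic ms)"
    and gen: "\<And>i. i < length ms \<Longrightarrow> ms ! i \<noteq> 1 \<Longrightarrow> [(i, 1)] \<in> K"
    and w: "w \<in> carrier (free_product_cyclic ms)"
  shows "w \<in> K"
proof -
  interpret P: group "free_product_cyclic ms" by simp
  interpret K: subgroup K "free_product_cyclic ms" by (rule sub)
  let ?s = "\<lambda>i k. if k mod int (ms ! i) = 0 then [] else [(i, k mod int (ms ! i))]"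
  have nat: "?s i (int k) \<in> K" if i: "i < length ms" "ms ! i \<noteq> 1" for i k
  proof (induction k)
    case 0
    show ?case using K.one_closed by simp
  next
    case (Suc k)
    have "?s i (int (Suc k)) = [(i, 1)] \<otimes>\<^bsub>free_product_cyclic ms\<^esub> ?s i (int k)"
    proof (cases "int k mod int (ms ! i) = 0")
      case True
      then have "int (Suc k) mod int (ms ! i) = 1 mod int (ms ! i)"
        using mod_add_right_eq[of 1 "int k" "int (ms ! i)"] by (simp add: add.commute)
      also have "\<dots> = 1"
        using i(2) by (cases "ms ! i = 0") auto
      finally show ?thesis
        using True by (simp add: mult_free_product_cyclic_Cons)
    next
      case False
      then show ?thesis
        by (simp add: syllable_mult mod_add_right_eq add.commute)
    qed
    then show ?case
      using K.m_closed[OF gen[OF i] Suc.IH] by simp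
  qed
  have syl: "[(i, k)] \<in> K" if "[(i, k)] \<in> carrier (free_product_cyclic ms)" for i k
  proof -
    have i: "i < length ms" "k \<in> carrier (integer_mod_group (ms ! i))" "k \<noteq> 0"
      using that by (auto simp: Cons_in_free_product_cyclic)
    then have m: "ms ! i \<noteq> 1" and k: "k mod int (ms ! i) = k"
      by (auto simp: carrier_integer_mod_group split: if_splits)
    show ?thesis
    proof (cases "k \<ge> 0")
      case True
      then show ?thesis using nat[OF i(1) m, of "nat k"] i k by simp
    next
      case False
      with i have 0: "ms ! i = 0"
        by (auto simp: carrier_integer_mod_group split: if_splits)
      have "[(i, - k)] \<in> K" using nat[OF i(1) m, of "nat (- k)"] i False 0 by simp
      moreover have "[(i, k)] \<otimes>\<^bsub>free_product_cyclic ms\<^esub> [(i, - k)] = []"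
        by (simp add: syllable_mult)
      ultimately show ?thesis
        using P.inv_equality[of "[(i, k)]" "[(i, - k)]"] that K.mem_carrier K.m_inv_closed
        by (metis one_free_product_cyclic)
    qed
  qed
  show ?thesis
    using w
  proof (induction rule: free_product_cyclic_induct)
    case Nil
    show ?case using K.one_closed by simp
  next
    case (syllable i k w)
    then show ?case using syl by (auto intro: K.m_closed)
  qed
qed

text \<open>
  The universal property: elements \<open>a i\<close> whose orders divide the orders of the factors determine a
  homomorphism, \<open>free_product_cyclic_lift\<close>, out of the free product.
\<close>

definition free_product_cyclic_lift ::
  "('a, 'b) monoid_scheme \<Rightarrow> (nat \<Rightarrow> 'a) \<Rightarrow> (nat \<times> int) list \<Rightarrow> 'a" where
  "free_product_cyclic_lift G a w = foldr (\<lambda>(i, k) g. a i [^]\<^bsub>G\<^esub> k \<otimes>\<^bsub>G\<^esub> g) w \<one>\<^bsub>G\<^esub>"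

lemma (in group) free_product_cyclic_lift:
  assumes a: "\<And>i. i < length ms \<Longrightarrow> a i \<in> carrier G"
    and ord: "\<And>i. i < length ms \<Longrightarrow> a i [^] (ms ! i) = \<one>"
  shows free_product_cyclic_lift_hom: "free_product_cyclic_lift G a \<in> hom (free_product_cyclic ms) G"
    and free_product_cyclic_lift_syllable:
      "i < length ms \<Longrightarrow> free_product_cyclic_lift G a [(i, k)] = a i [^] k"
proof -
  interpret P: group "free_product_cyclic ms" by simp
  let ?Z = "\<lambda>i. integer_mod_group (ms ! i)"
  let ?step = "\<lambda>(i, k) g. a i [^] (k :: int) \<otimes> g"
  have carr: "carrier (free_product_cyclic ms) = reduced_words {..<length ms} ?Z"
    by (simp add: free_product_cyclic_def free_product_def)
  have pow: "a i [^] (k mod int (ms ! i)) = a i [^] k" if i: "i < length ms" for i k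
  proof -
    have "a i [^] (int (ms ! i) * (k div int (ms ! i))) = (a i [^] int (ms ! i)) [^] (k div int (ms ! i))"
      using a[OF i] by (simp add: int_pow_pow)
    also have "\<dots> = \<one>"
      using ord[OF i] by (simp add: int_pow_int)
    finally have "a i [^] (int (ms ! i) * (k div int (ms ! i)) + k mod int (ms ! i)) = a i [^] (k mod int (ms ! i))"
      using int_pow_mult[OF a[OF i]] a[OF i] by (simp only: l_one int_pow_closed)
    then show ?thesis by simp
  qed
  have closed: "?step (i, k) s \<in> carrier G"
    if "i \<in> {..<length ms}" "k \<in> carrier (?Z i)" "s \<in> carrier G" for i k s
    using that a by simp
  have step: "foldr ?step (prepend_syllable ?Z (i, k) w) \<one> = ?step (i, k) (foldr ?step w \<one>)"
    if "i < length ms" "k \<in> carrier (?Z i)" "w \<in> carrier (free_product_cyclic ms)" for i k w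
  proof (rule foldr_step_prepend[where I = "{..<length ms}" and S = "carrier G"])
    show "?step (i, g \<otimes>\<^bsub>?Z i\<^esub> h) s = ?step (i, g) (?step (i, h) s)"
      if "i \<in> {..<length ms}" "s \<in> carrier G" for i g h s
      using that a by (simp add: pow int_pow_mult m_assoc)
  qed (use that a in \<open>auto simp: carr\<close>)
  have lift_closed: "free_product_cyclic_lift G a w \<in> carrier G"
    if "w \<in> carrier (free_product_cyclic ms)" for w
    unfolding free_product_cyclic_lift_def
    by (rule foldr_step_closed[where I = "{..<length ms}" and G = ?Z])
       (use that a in \<open>auto simp: carr\<close>)
  show syl: "free_product_cyclic_lift G a [(i, k)] = a i [^] k" if "i < length ms" for i k
    using a[OF that] by (simp add: free_product_cyclic_lift_def)
  show "free_product_cyclic_lift G a \<in> hom (free_product_cyclic ms) G"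
  proof (rule homI)
    fix u v
    assume u: "u \<in> carrier (free_product_cyclic ms)" and v: "v \<in> carrier (free_product_cyclic ms)"
    show "free_product_cyclic_lift G a (u \<otimes>\<^bsub>free_product_cyclic ms\<^esub> v) =
        free_product_cyclic_lift G a u \<otimes> free_product_cyclic_lift G a v"
      using u
    proof (induction u)
      case Nil
      show ?case
        using lift_closed[OF v] by (simp add: free_product_cyclic_lift_def)
    next
      case (Cons b u)
      obtain i k where b: "b = (i, k)" by (cases b)
      have ik: "i < length ms" "k \<in> carrier (?Z i)" "u \<in> carrier (free_product_cyclic ms)"
        using Cons.prems by (auto simp: b Cons_in_free_product_cyclic)
      have "free_product_cyclic_lift G a ((b # u) \<otimes>\<^bsub>free_product_cyclic ms\<^esub> v) =
          a i [^] k \<otimes> free_product_cyclic_lift G a (u \<otimes>\<^bsub>free_product_cyclic ms\<^esub> v)"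
        using step[OF ik(1,2) P.m_closed[OF ik(3) v]]
        by (simp add: b mult_free_product_cyclic_Cons free_product_cyclic_lift_def)
      also have "\<dots> = a i [^] k \<otimes> free_product_cyclic_lift G a u \<otimes> free_product_cyclic_lift G a v"
        using Cons.IH ik v a lift_closed by (simp add: m_assoc)
      also have "a i [^] k \<otimes> free_product_cyclic_lift G a u = free_product_cyclic_lift G a (b # u)"
        by (simp add: b free_product_cyclic_lift_def)
      finally show ?case .
    qed
  qed (rule lift_closed)
qed

section \<open>Torsion in free products of cyclic groups\<close>

lemma pow_cyclically_reduced:
  assumes "w \<in> carrier (free_product_cyclic ms)" "w \<noteq> []" "fst (last w) \<noteq> fst (hd w)"
  shows "w [^]\<^bsub>free_product_cyclic ms\<^esub> k = concat (replicate k w)"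
proof -
  interpret P: group "free_product_cyclic ms" by simp
  show ?thesis
  proof (induction k)
    case (Suc k)
    have "w [^]\<^bsub>free_product_cyclic ms\<^esub> Suc k = w \<otimes>\<^bsub>free_product_cyclic ms\<^esub> concat (replicate k w)"
      using assms(1) by (simp only: P.nat_pow_Suc2 Suc)
    also have "\<dots> = w @ concat (replicate k w)"
      by (rule mult_free_product_cyclic_append) (use assms in \<open>cases k; auto\<close>)+
    finally show ?case by simp
  qed simp
qed

text \<open>
  An element of finite order is conjugate into a factor: a conjugate of minimal length is either
  a single syllable or cyclically reduced, and cyclically reduced words of length at least two have
  infinite order. Here the factors have no nontrivial elements whose order divides \<open>q\<close>.
\<close>

lemma torsion_free_product_cyclic:
  assumes ms: "\<And>i. i < length ms \<Longrightarrow> ms ! i = 0 \<or> coprime (ms ! i) q"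
    and w: "w \<in> carrier (free_product_cyclic ms)"
    and pow: "w [^]\<^bsub>free_product_cyclic ms\<^esub> q = []" and q: "q > 0"
  shows "w = []"
  using w pow
proof (induction "length w" arbitrary: w rule: less_induct)
  case less
  interpret P: group "free_product_cyclic ms" by simp
  show ?case
  proof (rule ccontr)
    assume ne: "w \<noteq> []"
    then obtain i k v where w_eq: "w = (i, k) # v" by (metis surj_pair neq_Nil_conv)
    have i: "i < length ms" "k \<in> carrier (integer_mod_group (ms ! i))" "k \<noteq> 0"
      and v: "v \<in> carrier (free_product_cyclic ms)" "v = [] \<or> fst (hd v) \<noteq> i"
      using less.prems by (auto simp: w_eq Cons_in_free_product_cyclic)
    show False
    proof (cases "v = []")
      case True
      have "w [^]\<^bsub>free_product_cyclic ms\<^esub> n =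
          (if int n * k mod int (ms ! i) = 0 then [] else [(i, int n * k mod int (ms ! i))])" for n
      proof (induction n)
        case (Suc n)
        have "k mod int (ms ! i) = k"
          using i by (auto simp: carrier_integer_mod_group split: if_splits)
        moreover have "int (Suc n) * k mod int (ms ! i) = (int n * k mod int (ms ! i) + k) mod int (ms ! i)"
          using mod_add_left_eq[of "int n * k" "int (ms ! i)" k] by (simp add: distrib_right add.commute)
        ultimately show ?case
          using Suc True i(3) w_eq by (auto simp: syllable_mult)
      qed simp
      then have dvd: "int (ms ! i) dvd int q * k"
        using less.prems(2) by (auto split: if_splits)
      show False
      proof (cases "ms ! i = 0")
        case True
        then show False using dvd i(3) q by simp
      next
        case False
        then have "int (ms ! i) dvd k"
          using ms[OF i(1)] dvd by (simp add: coprime_dvd_mult_right_iff)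
        then show False
          using i False by (auto simp: carrier_integer_mod_group dest: zdvd_imp_le)
      qed
    next
      case False
      show False
      proof (cases "fst (last v) = i")
        case True
        let ?s = "[(i, k)]"
        have s: "?s \<in> carrier (free_product_cyclic ms)"
          using i by (simp add: Cons_in_free_product_cyclic)
        have w_sv: "w = ?s \<otimes>\<^bsub>free_product_cyclic ms\<^esub> v"
          using less.prems(1) w_eq by (simp add: syllable_mult_Cons)
        define w' where "w' = v \<otimes>\<^bsub>free_product_cyclic ms\<^esub> ?s"
        have w': "w' \<in> carrier (free_product_cyclic ms)"
          using v s by (simp add: w'_def)
        have "?s \<otimes>\<^bsub>free_product_cyclic ms\<^esub> w' [^]\<^bsub>free_product_cyclic ms\<^esub> n = w [^]\<^bsub>free_product_cyclic ms\<^esub> n \<otimes>\<^bsub>free_product_cyclic ms\<^esub> ?s" for n :: nat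
        proof (induction n)
          case (Suc n)
          then show ?case
            using s v w' less.prems(1)
            by (metis P.m_assoc P.nat_pow_Suc P.nat_pow_closed w'_def w_sv)
        qed (use s in simp)
        from this[of q] have "w' [^]\<^bsub>free_product_cyclic ms\<^esub> q = []"
          using less.prems(2) s w' by (simp add: P.r_cancel_one' P.r_cancel_one)
        moreover obtain u h where vu: "v = u @ [(i, h)]"
          using False True by (metis append_butlast_last_id prod.collapse)
        have "length w' < length w"
        proof -
          have u: "u \<in> carrier (free_product_cyclic ms)" "u = [] \<or> fst (last u) \<noteq> i"
            "[(i, h)] \<in> carrier (free_product_cyclic ms)"
            using append_in_free_product_cyclicD[of u "[(i, h)]"] v(1) by (auto simp: vu)
          have "v = u \<otimes>\<^bsub>free_product_cyclic ms\<^esub> [(i, h)]"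
            using u by (subst mult_free_product_cyclic_append) (auto simp: vu)
          then have "w' = u \<otimes>\<^bsub>free_product_cyclic ms\<^esub> ([(i, h)] \<otimes>\<^bsub>free_product_cyclic ms\<^esub> ?s)"
            using u s by (simp add: w'_def P.m_assoc)
          also have "\<dots> = u @ ([(i, h)] \<otimes>\<^bsub>free_product_cyclic ms\<^esub> ?s)"
            using u by (intro mult_free_product_cyclic_append) (auto simp: syllable_mult)
          finally show ?thesis
            by (simp add: w_eq vu syllable_mult)
        qed
        ultimately have "w' = []" using less.hyps[of w'] w' by blast
        then have "w = \<one>\<^bsub>free_product_cyclic ms\<^esub>"
          using w_sv s v unfolding w'_def
          by (metis P.inv_comm one_free_product_cyclic)
        then show False using ne by simp
      next
        case last: False
        then have "w [^]\<^bsub>free_product_cyclic ms\<^esub> q = concat (replicate q w)"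
          using False less.prems(1) by (intro pow_cyclically_reduced) (auto simp: w_eq)
        then show False using less.prems(2) q ne by simp
      qed
    qed
  qed
qed

section \<open>Actions of the Hecke group\<close>

text \<open>The generators of orders \<open>2\<close> and \<open>q\<close> of the Hecke group.\<close>

definition hecke_x :: "(nat \<times> int) list" where "hecke_x = [(0, 1)]"

definition hecke_y :: "(nat \<times> int) list" where "hecke_y = [(1, 1)]"

locale hecke = group H for H (structure) +
  fixes q :: nat
  assumes H_eq: "H = hecke_group q" and q_gt_1: "1 < q"
begin

lemma H_cyclic: "H = free_product_cyclic [2, q]"
  by (simp add: H_eq hecke_group_def)

lemma mult_inv_left: "a \<in> carrier H \<Longrightarrow> b \<in> carrier H \<Longrightarrow> a \<otimes> (inv a \<otimes> b) = b"
  by (simp flip: m_assoc)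

lemma inv_mult_left: "a \<in> carrier H \<Longrightarrow> b \<in> carrier H \<Longrightarrow> inv a \<otimes> (a \<otimes> b) = b"
  by (simp flip: m_assoc)

lemma one_H: "\<one> = []"
  by (simp add: H_cyclic)

lemma x_closed [simp]: "hecke_x \<in> carrier H"
  by (simp add: H_cyclic hecke_x_def Cons_in_free_product_cyclic)

lemma y_closed [simp]: "hecke_y \<in> carrier H"
  using q_gt_1 by (simp add: H_cyclic hecke_y_def Cons_in_free_product_cyclic)

lemma x_x: "hecke_x \<otimes> hecke_x = \<one>"
  by (simp add: H_cyclic hecke_x_def syllable_mult)

lemma x_x_left: "g \<in> carrier H \<Longrightarrow> hecke_x \<otimes> (hecke_x \<otimes> g) = g"
  by (simp add: x_x flip: m_assoc)

lemma y_pow: "k < q \<Longrightarrow> hecke_y [^] k = (if k = 0 then [] else [(1, int k)])" for k :: nat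
proof (induction k)
  case (Suc k)
  then have "int (Suc k) mod int q = int (Suc k)" by simp
  with Suc show ?case
    by (auto simp: H_cyclic hecke_y_def syllable_mult add.commute)
qed (simp add: H_cyclic)

lemma y_pow_q: "hecke_y [^] q = \<one>"
proof -
  obtain k where k: "q = Suc k" "k \<noteq> 0"
    using q_gt_1 by (cases q) auto
  then have "hecke_y [^] q = [(1, int k)] \<otimes> hecke_y"
    using y_pow[of k] by simp
  moreover have "(int k + 1) mod int q = 0"
    using k by (simp add: add.commute)
  ultimately show ?thesis
    by (simp add: H_cyclic hecke_y_def syllable_mult)
qed

lemma hecke_induct [consumes 1, case_names one x y]:
  assumes g: "g \<in> carrier H" and one: "Q \<one>"
    and x: "\<And>g. g \<in> carrier H \<Longrightarrow> Q g \<Longrightarrow> Q (hecke_x \<otimes> g)"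
    and y: "\<And>g. g \<in> carrier H \<Longrightarrow> Q g \<Longrightarrow> Q (hecke_y \<otimes> g)"
  shows "Q g"
proof -
  have ypow: "Q (hecke_y [^] k \<otimes> g)" if "g \<in> carrier H" "Q g" for k :: nat and g
  proof (induction k)
    case (Suc k)
    have "hecke_y [^] Suc k \<otimes> g = hecke_y \<otimes> (hecke_y [^] k \<otimes> g)"
      using that nat_pow_Suc2[OF y_closed, of k] by (simp only: m_assoc y_closed nat_pow_closed)
    then show ?case using y Suc that by simp
  qed (use that in simp)
  have "g \<in> carrier (free_product_cyclic [2, q])" using g by (simp add: H_cyclic)
  then show ?thesis
  proof (induction rule: free_product_cyclic_induct)
    case Nil
    show ?case using one by (simp add: one_H)
  next
    case (syllable i k w)
    then have "i = 0 \<or> i = 1" by (auto simp: Cons_in_free_product_cyclic)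
    with syllable(1) consider "i = 0" "k = 1" | "i = 1" "0 < k" "k < int q"
      using q_gt_1 by (auto simp: Cons_in_free_product_cyclic carrier_integer_mod_group)
    then show ?case
    proof cases
      case 1
      then show ?thesis using x[of w] syllable by (simp add: H_cyclic hecke_x_def)
    next
      case 2
      then have "[(i, k)] = hecke_y [^] nat k" by (subst y_pow) auto
      then show ?thesis using ypow[of w "nat k"] syllable by (simp add: H_cyclic)
    qed
  qed
qed

end

lemma (in hecke) y_pow_noncancel:
  "0 < k \<Longrightarrow> k < q \<Longrightarrow> hecke_y [^] k \<noteq> \<one>" for k :: nat
  by (simp add: y_pow one_H)

lemma hecke_hecke_group: "1 < q \<Longrightarrow> hecke (hecke_group q) q"
  by (simp add: hecke_def hecke_axioms_def group_hecke_group)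

text \<open>
  By the universal property of the free product, an action of the Hecke group on a set \<open>S\<close> is a pair
  of maps \<open>X\<close>, \<open>Y\<close> on \<open>S\<close> with \<open>X\<^sup>2 = Y\<^sup>q = 1\<close>.
\<close>

locale hecke_action = hecke +
  fixes X Y :: "'s \<Rightarrow> 's" and S :: "'s set"
  assumes X_closed: "s \<in> S \<Longrightarrow> X s \<in> S" and Y_closed: "s \<in> S \<Longrightarrow> Y s \<in> S"
    and X_X: "s \<in> S \<Longrightarrow> X (X s) = s" and Y_q: "s \<in> S \<Longrightarrow> (Y ^^ q) s = s"
begin

text \<open>
  The exponent \<open>k\<close> of a syllable is a representative of its residue class, \<open>0 \<le> k\<close>, so that it may
  be read as a number of iterations.
\<close>

definition act :: "(nat \<times> int) list \<Rightarrow> 's \<Rightarrow> 's" where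
  "act w s = foldr (\<lambda>(i, k). (if i = 0 then X else Y) ^^ nat k) w s"

lemma act_one [simp]: "act \<one> s = s"
  by (simp add: act_def one_H)

lemma funpow_closed: "s \<in> S \<Longrightarrow> (X ^^ k) s \<in> S" "s \<in> S \<Longrightarrow> (Y ^^ k) s \<in> S"
  by (induction k) (auto intro: X_closed Y_closed)

lemma act_syllable_mult:
  assumes "(i, k) \<in> {(0, 1), (1, 1)}" "g \<in> carrier H" "s \<in> S"
  shows "act ([(i, k)] \<otimes> g) s = ((if i = 0 then X else Y) ^^ nat k) (act g s)"
proof -
  let ?Z = "\<lambda>i. integer_mod_group ([2, q] ! i)"
  let ?F = "\<lambda>i :: nat. if i = 0 then X else Y"
  let ?step = "\<lambda>(i, k). ?F i ^^ nat k"
  have "foldr ?step (prepend_syllable ?Z (i, k) g) s = ?step (i, k) (foldr ?step g s)"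
  proof (rule foldr_step_prepend[where I = "{..<2}" and S = S])
    fix i :: nat and a b t
    assume "i \<in> {..<2}" and ab: "a \<in> carrier (?Z i)" "b \<in> carrier (?Z i)" and t: "t \<in> S"
    then have i: "i = 0 \<or> i = 1" by auto
    then have m: "[2, q] ! i \<noteq> 0" using q_gt_1 by auto
    have period: "(?F i ^^ ([2, q] ! i)) t = t"
      using i X_X Y_q t by (auto simp: numeral_2_eq_2)
    have "nat ((a + b) mod int ([2, q] ! i)) = (nat a + nat b) mod ([2, q] ! i)"
      using ab m by (simp add: carrier_integer_mod_group nat_add_distrib nat_mod_distrib split: if_splits)
    then have "?step (i, a \<otimes>\<^bsub>?Z i\<^esub> b) t = (?F i ^^ ((nat a + nat b) mod ([2, q] ! i))) t"
      by (simp only: mult_integer_mod_group split)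
    also have "\<dots> = (?F i ^^ (nat a + nat b)) t"
      by (rule funpow_mod_eq[OF period])
    finally show "?step (i, a \<otimes>\<^bsub>?Z i\<^esub> b) t = ?step (i, a) (?step (i, b) t)"
      by (simp add: funpow_add)
  next
    show "i \<in> {..<2}" "k \<in> carrier (?Z i)"
      using assms(1) q_gt_1 by auto
    show "g \<in> reduced_words {..<2} ?Z"
      using assms(2) by (simp add: H_cyclic free_product_cyclic_def free_product_def numeral_2_eq_2)
  qed (use assms funpow_closed in auto)
  then show ?thesis
    by (simp add: act_def H_cyclic mult_free_product_cyclic_Cons)
qed

lemma act_x: "g \<in> carrier H \<Longrightarrow> s \<in> S \<Longrightarrow> act (hecke_x \<otimes> g) s = X (act g s)"
  using act_syllable_mult[of 0 1 g s] by (simp add: hecke_x_def)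

lemma act_y: "g \<in> carrier H \<Longrightarrow> s \<in> S \<Longrightarrow> act (hecke_y \<otimes> g) s = Y (act g s)"
  using act_syllable_mult[of 1 1 g s] by (simp add: hecke_y_def)

lemma act_closed: "g \<in> carrier H \<Longrightarrow> s \<in> S \<Longrightarrow> act g s \<in> S"
  by (induction rule: hecke_induct) (auto simp: act_x act_y X_closed Y_closed)

lemma act_mult:
  "g \<in> carrier H \<Longrightarrow> h \<in> carrier H \<Longrightarrow> s \<in> S \<Longrightarrow> act (g \<otimes> h) s = act g (act h s)"
  by (induction rule: hecke_induct) (auto simp: act_x act_y m_assoc act_closed)

lemma act_inv: "g \<in> carrier H \<Longrightarrow> s \<in> S \<Longrightarrow> act (inv g) (act g s) = s"
  by (simp flip: act_mult)

lemma subgroup_stabilizer: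
  assumes "s \<in> S"
  shows "subgroup {g \<in> carrier H. act g s = s} H"
proof (rule subgroupI)
  show "inv g \<in> {g \<in> carrier H. act g s = s}" if "g \<in> {g \<in> carrier H. act g s = s}" for g
    using that act_inv[of g s] assms by auto
qed (use assms in \<open>auto simp: act_mult intro: exI[of _ \<one>]\<close>)

end

section \<open>Cosets and transversals\<close>

lemma (in group) rcos_inv_eq_iff:
  assumes "subgroup D G" "a \<in> carrier G" "b \<in> carrier G"
  shows "D #> inv a = D #> inv b \<longleftrightarrow> inv a \<otimes> b \<in> D"
proof -
  have "D #> inv b = D #> inv a \<longleftrightarrow> inv a \<in> D #> inv b"
    using assms rcos_self[of "inv a" D] repr_independence[of "inv a" D "inv b"] by auto
  also have "\<dots> \<longleftrightarrow> inv a \<otimes> b \<in> D"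
    using subgroup.rcos_module[OF assms(1) is_group, of "inv b" "inv a"] assms by simp
  finally show ?thesis by auto
qed

text \<open>
  The left cosets \<open>g D\<close>, on which the group acts from the left, correspond to the right cosets
  \<open>D g\<inverse>\<close>. Accordingly \<open>r\<close> is a left transversal, and \<open>p \<mapsto> D (r p)\<inverse>\<close> enumerates the right cosets.
\<close>

lemma (in group) bij_betw_transversal_rcosets:
  assumes D: "subgroup D G" and r: "\<And>p. p \<in> A \<Longrightarrow> r p \<in> carrier G"
    and inj: "\<And>p p'. p \<in> A \<Longrightarrow> p' \<in> A \<Longrightarrow> inv (r p) \<otimes> r p' \<in> D \<Longrightarrow> p = p'"
    and surj: "\<And>g. g \<in> carrier G \<Longrightarrow> \<exists>p\<in>A. inv g \<otimes> r p \<in> D"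
  shows "bij_betw (\<lambda>p. D #> inv (r p)) A (rcosets D)"
proof (rule bij_betwI')
  show "(D #> inv (r p) = D #> inv (r p')) = (p = p')" if "p \<in> A" "p' \<in> A" for p p'
    using that inj r rcos_inv_eq_iff[OF D] subgroup.one_closed[OF D] by auto
  show "D #> inv (r p) \<in> rcosets D" if "p \<in> A" for p
    using that r rcosetsI[OF subgroup.subset[OF D]] by simp
  show "\<exists>p\<in>A. c = D #> inv (r p)" if "c \<in> rcosets D" for c
  proof -
    from that obtain g where g: "g \<in> carrier G" "c = D #> g" by (auto simp: RCOSETS_def)
    then obtain p where p: "p \<in> A" "inv (inv g) \<otimes> r p \<in> D" using surj[of "inv g"] by auto
    then show ?thesis using g r rcos_inv_eq_iff[OF D, of "inv g" "r p"] by auto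
  qed
qed

section \<open>Canonically labelled actions\<close>

text \<open>
  For \<open>q > 0\<close>, the permutation of the natural numbers whose cycles are the intervals
  \<open>{q * j..<q * Suc j}\<close>, each traversed in increasing order.
\<close>

definition standard_cycle :: "nat \<Rightarrow> nat \<Rightarrow> nat" where
  "standard_cycle q p = q * (p div q) + Suc p mod q"

lemma standard_cycle_funpow:
  assumes "0 < q"
  shows "(standard_cycle q ^^ k) p = q * (p div q) + (p + k) mod q"
proof (induction k)
  case (Suc k)
  have "(standard_cycle q ^^ Suc k) p = standard_cycle q (q * (p div q) + (p + k) mod q)"
    using Suc by simp
  also have "\<dots> = q * (p div q) + (p + Suc k) mod q"
    using assms by (simp add: standard_cycle_def mod_Suc_eq)
  finally show ?case .
qed simp

lemma standard_cycle_less: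
  assumes "p < q * m"
  shows "standard_cycle q p < q * m"
proof -
  have q: "0 < q" using assms by (cases q) auto
  have "standard_cycle q p < q * (p div q) + q"
    using q by (simp add: standard_cycle_def)
  also have "\<dots> \<le> q * m"
    using assms q less_mult_imp_div_less[of p m q] mult_le_mono2[of "Suc (p div q)" m q]
    by (simp add: mult.commute)
  finally show ?thesis .
qed

text \<open>
  An involution \<open>X\<close> of \<open>{..<n}\<close> is canonical if the labelling is the one that breadth-first search
  produces: the cycles of \<open>standard_cycle q\<close> are numbered in the order in which they are first
  reached from the cycle of \<open>0\<close>, the points being scanned in increasing order, and a cycle is entered
  at its least point. Thus \<open>e\<close> is the first point that \<open>X\<close> maps outside the first \<open>j\<close> cycles.
\<close>

definition canonical_involutions :: "nat \<Rightarrow> nat \<Rightarrow> (nat \<Rightarrow> nat) set" where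
  "canonical_involutions q n =
     {X. X permutes {..<n} \<and> X \<circ> X = id \<and>
         (\<forall>j>0. q * j < n \<longrightarrow> (\<exists>e<q * j. X e = q * j \<and> (\<forall>p<e. X p < q * j)))}"

text \<open>
  A transitive action of the Hecke group on \<open>{..<q * m}\<close>, in its canonical labelling: \<open>x\<close> acts by the
  canonical involution \<open>X\<close>, and \<open>y\<close> by \<open>standard_cycle q\<close>.
\<close>

locale canonical_action = hecke +
  fixes m :: nat and X :: "nat \<Rightarrow> nat"
  assumes m_pos: "0 < m" and X_canonical: "X \<in> canonical_involutions q (q * m)"
begin

lemma X_less_iff: "X p < q * m \<longleftrightarrow> p < q * m"
  using X_canonical permutes_in_image[of X "{..<q * m}" p] by (auto simp: canonical_involutions_def)

lemma X_involution [simp]: "X (X p) = p"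
  using X_canonical by (auto simp: canonical_involutions_def fun_eq_iff)

lemma X_eq_iff: "X p = X p' \<longleftrightarrow> p = p'"
  by (metis X_involution)

lemma X_entry:
  assumes "q dvd p" "0 < p" "p < q * m"
  shows "\<exists>e<p. X e = p \<and> (\<forall>a<e. X a < p)"
proof -
  obtain j where j: "p = q * j" using assms(1) by auto
  then have "0 < j" "q * j < q * m" using assms by auto
  moreover have "\<forall>j>0. q * j < q * m \<longrightarrow> (\<exists>e<q * j. X e = q * j \<and> (\<forall>p<e. X p < q * j))"
    using X_canonical by (simp add: canonical_involutions_def)
  ultimately show ?thesis using j by blast
qed

lemma X_entry_less:
  assumes "q dvd p" "0 < p" "p < q * m"
  shows "X p < p"
  using X_entry[OF assms] X_involution by metis

sublocale hecke_action H q X "standard_cycle q" "{..<q * m}"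
proof unfold_locales
  show "(standard_cycle q ^^ q) p = p" for p
    using q_gt_1 by (subst standard_cycle_funpow) auto
qed (auto simp: X_less_iff standard_cycle_less)

lemma pos [simp]: "0 < m" "0 < q"
  using m_pos q_gt_1 by auto

text \<open>
  Coset representatives along the breadth-first search tree: a cycle is entered through the
  \<open>X\<close>-edge at its least point, and is then followed by \<open>y\<close>. The last alternative, which serves
  termination, does not occur for \<open>p < q * m\<close>.
\<close>

function rep :: "nat \<Rightarrow> (nat \<times> int) list" where
  "rep p = (if p = 0 then \<one>
            else if p mod q \<noteq> 0 then hecke_y \<otimes> rep (p - 1)
            else if X p < p then hecke_x \<otimes> rep (X p) else \<one>)"
  by auto
termination by (relation "measure id") auto

declare rep.simps [simp del]

lemma rep_zero [simp]: "rep 0 = \<one>"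
  by (simp add: rep.simps)

lemma rep_Suc: "Suc p mod q \<noteq> 0 \<Longrightarrow> rep (Suc p) = hecke_y \<otimes> rep p"
  by (simp add: rep.simps)

lemma rep_entry: "q dvd p \<Longrightarrow> 0 < p \<Longrightarrow> p < q * m \<Longrightarrow> rep p = hecke_x \<otimes> rep (X p)"
  using X_entry_less[of p] by (subst rep.simps) simp

text \<open>Induction along the breadth-first search tree.\<close>

lemma tree_induct [consumes 1, case_names zero Suc entry]:
  assumes "p < q * m" and "Q 0"
    and "\<And>p. Suc p < q * m \<Longrightarrow> Suc p mod q \<noteq> 0 \<Longrightarrow> Q p \<Longrightarrow> Q (Suc p)"
    and "\<And>p. q dvd p \<Longrightarrow> 0 < p \<Longrightarrow> p < q * m \<Longrightarrow> Q (X p) \<Longrightarrow> Q p"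
  shows "Q p"
  using assms(1)
proof (induction p rule: less_induct)
  case (less p)
  consider "p = 0" | p' where "p = Suc p'" "p mod q \<noteq> 0" | "q dvd p" "0 < p"
    by (cases p) auto
  then show ?case
  proof cases
    case 3
    then show ?thesis using X_entry_less[of p] less assms(4) by simp
  qed (use assms less in auto)
qed

lemma rep_closed: "p < q * m \<Longrightarrow> rep p \<in> carrier H"
  by (induction rule: tree_induct) (auto simp: rep_Suc rep_entry)

lemma standard_cycle_Suc: "Suc p mod q \<noteq> 0 \<Longrightarrow> standard_cycle q p = Suc p"
  using mult_div_mod_eq[of q "Suc p"] by (simp add: standard_cycle_def div_Suc)

lemma act_rep: "p < q * m \<Longrightarrow> act (rep p) 0 = p"
proof (induction rule: tree_induct)
  case (Suc p)
  then show ?case by (simp add: rep_Suc act_y rep_closed standard_cycle_Suc)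
next
  case (entry p)
  then show ?case by (simp add: rep_entry act_x rep_closed X_less_iff)
qed simp

lemma rep_standard_cycle:
  assumes "p < q * m"
  shows "rep (standard_cycle q p) = hecke_y \<otimes> rep p"
proof (cases "Suc p mod q = 0")
  case False
  then show ?thesis by (simp add: standard_cycle_Suc rep_Suc)
next
  case True
  \<comment> \<open>The last point of a cycle is reached from the first one by \<open>y\<^sup>q\<^sup>-\<^sup>1\<close>.\<close>
  let ?b = "q * (p div q)"
  have b: "?b < q * m" using assms by (rule le_less_trans[rotated]) simp
  have run: "rep (?b + i) = hecke_y [^] i \<otimes> rep ?b" if "i < q" for i
    using that
  proof (induction i)
    case 0
    then show ?case using b by (simp add: rep_closed)
  next
    case (Suc i)
    then have "rep (?b + Suc i) = hecke_y \<otimes> rep (?b + i)" by (simp add: rep_Suc)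
    also have "\<dots> = hecke_y \<otimes> (hecke_y [^] i \<otimes> rep ?b)" using Suc by simp
    also have "\<dots> = hecke_y [^] Suc i \<otimes> rep ?b"
      using nat_pow_Suc2[OF y_closed, of i] b by (simp add: m_assoc rep_closed)
    finally show ?case .
  qed
  have "Suc (p mod q) = q"
    using True by (simp add: mod_Suc split: if_splits)
  then have p: "p = ?b + (q - 1)" and q: "q = Suc (q - 1)"
    using mult_div_mod_eq[of q p] by linarith+
  have "hecke_y \<otimes> rep p = hecke_y \<otimes> (hecke_y [^] (q - 1) \<otimes> rep ?b)"
    using run[of "q - 1"] p q_gt_1 by simp
  also have "\<dots> = hecke_y [^] Suc (q - 1) \<otimes> rep ?b"
    using nat_pow_Suc2[OF y_closed, of "q - 1"] b by (simp add: m_assoc rep_closed)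
  also have "\<dots> = rep ?b"
    using b q y_pow_q by (simp add: rep_closed)
  finally show ?thesis using True by (simp add: standard_cycle_def)
qed

abbreviation stab :: "(nat \<times> int) list set" where
  "stab \<equiv> {g \<in> carrier H. act g 0 = 0}"

lemma subgroup_stab: "subgroup stab H"
  by (rule subgroup_stabilizer) simp

lemma inv_mult_in_stab_iff:
  assumes "g \<in> carrier H" "h \<in> carrier H"
  shows "inv g \<otimes> h \<in> stab \<longleftrightarrow> act g 0 = act h 0"
proof
  assume "inv g \<otimes> h \<in> stab"
  then have "act (g \<otimes> (inv g \<otimes> h)) 0 = act g 0"
    using assms by (simp add: act_mult)
  moreover have "g \<otimes> (inv g \<otimes> h) = h"
    using assms by (simp flip: m_assoc)
  ultimately show "act g 0 = act h 0" by simp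
next
  assume "act g 0 = act h 0"
  then show "inv g \<otimes> h \<in> stab"
    using assms act_inv[of g 0] by (simp add: act_mult)
qed

lemma index_stab: "card (rcosets stab) = q * m"
proof -
  have "bij_betw (\<lambda>p. stab #> inv (rep p)) {..<q * m} (rcosets stab)"
  proof (rule bij_betw_transversal_rcosets[OF subgroup_stab])
    fix g assume "g \<in> carrier H"
    then show "\<exists>p\<in>{..<q * m}. inv g \<otimes> rep p \<in> stab"
      using act_closed[of g 0] inv_mult_in_stab_iff[of g "rep (act g 0)"]
      by (auto simp: rep_closed act_rep)
  next
    fix p p' assume "p \<in> {..<q * m}" "p' \<in> {..<q * m}" "inv (rep p) \<otimes> rep p' \<in> stab"
    then show "p = p'"
      using inv_mult_in_stab_iff[of "rep p" "rep p'"] by (auto simp: rep_closed act_rep)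
  qed (use rep_closed in auto)
  from bij_betw_same_card[OF this] show ?thesis by simp
qed

section \<open>Point stabilizers as free products\<close>

text \<open>
  The stabilizer of \<open>0\<close> is a free product with one factor for each edge outside of the search tree: a
  fixed point of \<open>X\<close> contributes a factor \<open>C\<^sub>2\<close>, and a transposed pair that is not a tree edge contributes an
  infinite cyclic factor. The isomorphism \<open>phi\<close> records the edges that a word traverses; it is read
  off from an action of the Hecke group on \<open>{..<q * m} \<times> P\<close>, where \<open>P\<close> is the free product. The
  homomorphism \<open>psi\<close> in the other direction maps a generator to the loop through its edge.
\<close>

lemma kurosh_type_stab: "\<exists>l v. kurosh_type q (H\<lparr>carrier := stab\<rparr>) l 0 v"
proof -
  \<comment> \<open>\<open>F\<close> are the fixed points; \<open>E\<close> contains the greater end of each transposed pair that is not a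
    tree edge. The greater end of a tree edge is the first point of a cycle.\<close>
  define F where "F = {p. p < q * m \<and> X p = p}"
  define E where "E = {p. p < q * m \<and> X p < p \<and> \<not> q dvd p}"
  define ps where "ps = sorted_list_of_set F @ sorted_list_of_set E"
  define ms where "ms = map (\<lambda>p. if X p = p then 2 else 0 :: nat) ps"
  let ?P = "free_product_cyclic ms"
  interpret P: group ?P by simp
  have fin: "finite F" "finite E" by (auto simp: F_def E_def)
  have set_ps: "set ps = F \<union> E" using fin by (simp add: ps_def)
  have ms: "ms = replicate (card F) 2 @ replicate 0 q @ replicate (card E) 0"
  proof -
    have "map (\<lambda>p. if X p = p then 2 else 0) (sorted_list_of_set F) = replicate (card F) (2 :: nat)"
      using fin by (intro replicate_eqI) (auto simp: F_def)
    moreover have "map (\<lambda>p. if X p = p then 2 else 0) (sorted_list_of_set E) = replicate (card E) (0 :: nat)"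
      using fin by (intro replicate_eqI) (auto simp: E_def)
    ultimately show ?thesis by (simp add: ms_def ps_def)
  qed
  have dist: "distinct ps"
    using fin by (auto simp: ps_def F_def E_def)
  define idx where "idx p = (SOME i. i < length ps \<and> ps ! i = p)" for p
  have idx: "idx p < length ps" "ps ! idx p = p" if "p \<in> F \<union> E" for p
  proof -
    have "\<exists>i. i < length ps \<and> ps ! i = p"
      using that by (simp add: in_set_conv_nth flip: set_ps)
    from someI_ex[OF this] show "idx p < length ps" "ps ! idx p = p" by (auto simp: idx_def)
  qed
  have idx_nth: "idx (ps ! i) = i" if "i < length ps" for i
  proof -
    have "ps ! i \<in> F \<union> E" using that by (simp flip: set_ps)
    from idx[OF this] show ?thesis using that dist by (simp add: nth_eq_iff_index_eq)
  qed
  have ms_idx: "ms ! idx p = (if X p = p then 2 else 0)" if "p \<in> F \<union> E" for p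
    using idx[OF that] by (simp add: ms_def)
  \<comment> \<open>The element of \<open>P\<close> that is recorded when \<open>x\<close> is applied at \<open>p\<close>.\<close>
  define u where "u p = (if p \<in> F \<union> E then [(idx p, 1)]
      else if X p \<in> E then [(idx (X p), - 1)] else [] :: (nat \<times> int) list)" for p
  have u_closed: "u p \<in> carrier ?P" for p
    using idx ms_idx
    by (auto simp: u_def Cons_in_free_product_cyclic carrier_integer_mod_group ms_def F_def E_def)
  have u_u: "u (X p) \<otimes>\<^bsub>?P\<^esub> u p = []" if p: "p < q * m" for p
  proof -
    consider "p \<in> F" | "p \<in> E" | "p \<notin> F \<union> E" "X p \<in> E" | "p \<notin> F \<union> E" "X p \<notin> F \<union> E"
      using p by (auto simp: F_def X_eq_iff)
    then show ?thesis
    proof cases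
      case 1
      then have "X p = p" by (simp add: F_def)
      then show ?thesis using 1 ms_idx[of p] by (simp add: u_def syllable_mult)
    next
      case 2
      then have "X p \<notin> F \<union> E" by (auto simp: E_def F_def)
      then show ?thesis using 2 by (simp add: u_def syllable_mult)
    next
      case 3
      then show ?thesis by (simp add: u_def syllable_mult)
    next
      case 4
      then show ?thesis by (simp add: u_def)
    qed
  qed
  let ?X = "\<lambda>(p, a). (X p, u p \<otimes>\<^bsub>?P\<^esub> a)" and ?Y = "\<lambda>(p, a). (standard_cycle q p, a)"
  have Y_pow: "(?Y ^^ k) (p, a) = ((standard_cycle q ^^ k) p, a)" for k p and a :: "(nat \<times> int) list"
    by (induction k) auto
  interpret A: hecke_action H q ?X ?Y "{..<q * m} \<times> carrier ?P"
  proof unfold_locales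
    fix s assume s: "s \<in> {..<q * m} \<times> carrier ?P"
    show "?X s \<in> {..<q * m} \<times> carrier ?P"
      using s u_closed by (auto simp: X_less_iff)
    show "?Y s \<in> {..<q * m} \<times> carrier ?P"
      using s by (auto simp: standard_cycle_less)
    show "?X (?X s) = s"
      using s u_closed u_u by (auto simp flip: P.m_assoc)
    show "(?Y ^^ q) s = s"
      using s Y_q by (auto simp: Y_pow)
  qed
  \<comment> \<open>The cocycle of the action: \<open>c g p\<close> is the element that is recorded when \<open>g\<close> is applied at \<open>p\<close>.\<close>
  define c where "c g p = snd (A.act g (p, []))" for g p
  have A_Nil: "A.act g (p, []) = (act g p, c g p) \<and> c g p \<in> carrier ?P"
    if g: "g \<in> carrier H" and p: "p < q * m" for g p
  proof -
    have "fst (A.act g (p, [])) = act g p"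
      using g by (induction rule: hecke_induct) (use p in \<open>auto simp: A.act_x A.act_y act_x act_y split: prod.splits\<close>)
    then show ?thesis
      using A.act_closed[OF g, of "(p, [])"] p by (auto simp: c_def mem_Times_iff prod_eq_iff)
  qed
  have c_closed: "c g p \<in> carrier ?P" if "g \<in> carrier H" "p < q * m" for g p
    using A_Nil[OF that] by simp
  have c_one: "c \<one> p = []" for p
    by (simp add: c_def)
  have c_x: "c (hecke_x \<otimes> g) p = u (act g p) \<otimes>\<^bsub>?P\<^esub> c g p"
    if "g \<in> carrier H" "p < q * m" for g p
    using A.act_x[OF that(1), of "(p, [])"] A_Nil[OF that] that by (subst c_def) simp
  have c_y: "c (hecke_y \<otimes> g) p = c g p" if "g \<in> carrier H" "p < q * m" for g p
    using A.act_y[OF that(1), of "(p, [])"] A_Nil[OF that] that by (subst c_def) simp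
  have A_act: "A.act g (p, a) = (act g p, c g p \<otimes>\<^bsub>?P\<^esub> a)"
    if "g \<in> carrier H" "p < q * m" "a \<in> carrier ?P" for g p a
    using that(1) by (induction rule: hecke_induct)
      (use that in \<open>auto simp: A.act_x A.act_y act_x act_y c_one c_x c_y P.m_assoc u_closed c_closed\<close>)
  have c_mult: "c (g \<otimes> h) p = c g (act h p) \<otimes>\<^bsub>?P\<^esub> c h p"
    if g: "g \<in> carrier H" and h: "h \<in> carrier H" and p: "p < q * m" for g h p
  proof -
    have "A.act (g \<otimes> h) (p, []) = A.act g (A.act h (p, []))"
      using g h p by (simp add: A.act_mult)
    also have "\<dots> = (act g (act h p), c g (act h p) \<otimes>\<^bsub>?P\<^esub> c h p)"
      using g h p A_Nil[OF h p] act_closed[OF h, of p] by (simp add: A_act)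
    finally show ?thesis by (subst c_def) simp
  qed
  have c_rep: "c (rep p) 0 = []" if "p < q * m" for p
    using that
  proof (induction rule: tree_induct)
    case (entry p)
    then have "X p \<notin> F \<union> E" "p \<notin> E"
      using X_entry_less[of p] by (auto simp: F_def E_def)
    then show ?case
      using entry by (simp add: rep_entry c_x rep_closed X_less_iff act_rep u_def)
  qed (auto simp: c_one rep_Suc c_y rep_closed)
  define loop where "loop p = inv (rep (X p)) \<otimes> (hecke_x \<otimes> rep p)" for p
  have loop_closed: "loop p \<in> carrier H" if "p < q * m" for p
    using that by (simp add: loop_def rep_closed X_less_iff)
  have loop_X: "loop (X p) = inv (loop p)" if p: "p < q * m" for p
  proof (rule inv_equality[symmetric])
    have "loop (X p) \<otimes> loop p =
        inv (rep p) \<otimes> (hecke_x \<otimes> (rep (X p) \<otimes> (inv (rep (X p)) \<otimes> (hecke_x \<otimes> rep p))))"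
      using p by (simp add: loop_def rep_closed X_less_iff m_assoc)
    also have "\<dots> = \<one>"
      using p by (simp add: rep_closed X_less_iff mult_inv_left x_x_left)
    finally show "loop (X p) \<otimes> loop p = \<one>" .
  qed (use p in \<open>simp_all add: loop_closed X_less_iff\<close>)
  have ps_less: "ps ! i < q * m" if "i < length ms" for i
    using nth_mem[of i ps] that set_ps by (auto simp: ms_def F_def E_def)
  define psi where "psi = free_product_cyclic_lift H (\<lambda>i. loop (ps ! i))"
  have ord: "loop (ps ! i) [^] (ms ! i) = \<one>" if i: "i < length ms" for i
  proof (cases "X (ps ! i) = ps ! i")
    case True
    then have "loop (ps ! i) = inv (loop (ps ! i))"
      using loop_X[of "ps ! i"] ps_less[OF i] by simp
    then have "loop (ps ! i) \<otimes> loop (ps ! i) = \<one>"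
      using loop_closed[OF ps_less[OF i]] by (metis r_inv)
    then show ?thesis
      using True i loop_closed[OF ps_less[OF i]] by (simp add: ms_def numeral_2_eq_2)
  qed (use i in \<open>simp add: ms_def\<close>)
  have psi_hom: "psi \<in> hom ?P H"
    unfolding psi_def
    by (rule free_product_cyclic_lift_hom) (use ord loop_closed ps_less in auto)
  have psi_syl: "psi [(i, k)] = loop (ps ! i) [^] k" if "i < length ms" for i k
    unfolding psi_def
    by (rule free_product_cyclic_lift_syllable[of ms]) (use that ord loop_closed ps_less in auto)
  interpret psi: group_hom ?P H psi
    by unfold_locales (rule psi_hom)
  have psi_u: "psi (u p) = loop p" if p: "p < q * m" for p
  proof -
    consider "p \<in> F \<union> E" | "p \<notin> F \<union> E" "X p \<in> E" | "p \<notin> F \<union> E" "X p \<notin> F \<union> E"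
      using p by (auto simp: F_def X_eq_iff)
    then show ?thesis
    proof cases
      case 1
      then show ?thesis
        using idx[OF 1] loop_closed[OF p] by (simp add: u_def psi_syl ms_def)
    next
      case 2
      then have "psi (u p) = inv (loop (X p))"
        using idx[of "X p"] loop_closed[of "X p"] p
        by (simp add: u_def psi_syl ms_def int_pow_neg X_less_iff)
      then show ?thesis using loop_X[of "X p"] p by (simp add: X_less_iff)
    next
      case 3
      \<comment> \<open>A tree edge: its greater end is the first point of a cycle.\<close>
      then have "psi (u p) = \<one>"
        using psi.hom_one by (simp add: u_def)
      moreover have "loop p = \<one>"
      proof (cases "X p < p")
        case True
        then have "q dvd p" "0 < p" using 3 p by (auto simp: E_def)
        then show ?thesis
          using p by (simp add: loop_def rep_entry[of p] x_x_left rep_closed X_less_iff)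
      next
        case False
        then have "p < X p" using 3 p by (auto simp: F_def)
        then have "q dvd X p" "0 < X p" using 3 p by (auto simp: E_def X_less_iff)
        then show ?thesis
          using p rep_entry[of "X p"] by (simp add: loop_def rep_closed X_less_iff)
      qed
      ultimately show ?thesis by simp
    qed
  qed
  have psi_c: "psi (c g p) = inv (rep (act g p)) \<otimes> (g \<otimes> rep p)"
    if "g \<in> carrier H" "p < q * m" for g p
    using that(1)
  proof (induction rule: hecke_induct)
    case one
    show ?case using that psi.hom_one by (simp add: c_one rep_closed)
  next
    case (x g)
    have less: "act g p < q * m" using act_closed[OF x(1), of p] that by simp
    have "psi (c (hecke_x \<otimes> g) p) = loop (act g p) \<otimes> psi (c g p)"
      using x that less by (simp add: c_x psi.hom_mult u_closed c_closed psi_u)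
    also have "\<dots> = inv (rep (X (act g p))) \<otimes> (hecke_x \<otimes>
        (rep (act g p) \<otimes> (inv (rep (act g p)) \<otimes> (g \<otimes> rep p))))"
      using x that less by (simp add: loop_def m_assoc rep_closed X_less_iff)
    finally show ?case
      using x that less by (simp add: act_x rep_closed X_less_iff mult_inv_left m_assoc)
  next
    case (y g)
    have less: "act g p < q * m" using act_closed[OF y(1), of p] that by simp
    have "psi (c (hecke_y \<otimes> g) p) = inv (rep (act g p)) \<otimes> (g \<otimes> rep p)"
      using y that by (simp add: c_y)
    also have "\<dots> = inv (rep (act g p)) \<otimes> (inv hecke_y \<otimes> (hecke_y \<otimes> (g \<otimes> rep p)))"
      using y that less by (simp add: rep_closed inv_mult_left)
    also have "\<dots> = inv (hecke_y \<otimes> rep (act g p)) \<otimes> (hecke_y \<otimes> g \<otimes> rep p)"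
      using y that less by (simp add: rep_closed m_assoc inv_mult_group)
    finally show ?case
      using y that less by (simp add: act_y rep_standard_cycle)
  qed
  define phi where "phi g = c g 0" for g
  let ?D = "H\<lparr>carrier := stab\<rparr>"
  have phi_hom: "phi \<in> hom ?D ?P"
    by (rule homI) (auto simp: phi_def c_closed c_mult)
  have psi_phi: "psi (phi g) = g" if "g \<in> stab" for g
    using that by (simp add: phi_def psi_c)
  have phi_loop: "loop p \<in> stab \<and> phi (loop p) = u p" if p: "p < q * m" for p
  proof -
    have Xp: "X p < q * m" using p by (simp add: X_less_iff)
    have tail: "act (hecke_x \<otimes> rep p) 0 = X p" "c (hecke_x \<otimes> rep p) 0 = u p"
      using p by (simp_all add: act_x c_x rep_closed act_rep c_rep u_closed)
    have inv_rep: "act (inv (rep (X p))) (X p) = 0"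
      using act_inv[OF rep_closed[OF Xp], of 0] by (simp add: act_rep[OF Xp])
    have "[] = c (inv (rep (X p)) \<otimes> rep (X p)) 0"
      using Xp by (simp add: rep_closed c_one)
    also have "\<dots> = c (inv (rep (X p))) (X p)"
      using P.r_one[OF c_closed, of "inv (rep (X p))" "X p"] Xp
      by (subst c_mult) (simp_all add: rep_closed act_rep c_rep)
    finally have "c (inv (rep (X p))) (X p) = []" by simp
    then show ?thesis
      using p Xp tail inv_rep loop_closed[OF p]
      by (simp add: phi_def loop_def c_mult act_mult rep_closed)
  qed
  interpret phi: group_hom ?D ?P phi
    using subgroup.subgroup_is_group[OF subgroup_stab is_group] phi_hom
    by (simp add: group_hom_def group_hom_axioms_def)
  have "w \<in> phi ` stab" if "w \<in> carrier ?P" for w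
  proof (rule free_product_cyclic_generated[OF _ _ that])
    show "subgroup (phi ` stab) ?P"
      using phi.img_is_subgroup by simp
    show "[(i, 1)] \<in> phi ` stab" if "i < length ms" for i
    proof -
      have i: "i < length ps" using that by (simp add: ms_def)
      then have "ps ! i \<in> F \<union> E" by (simp flip: set_ps)
      then have "u (ps ! i) = [(i, 1)]" using idx_nth[OF i] by (simp add: u_def)
      then show ?thesis using phi_loop[OF ps_less[OF that]] by force
    qed
  qed
  then have "bij_betw phi stab (carrier ?P)"
    using psi_phi phi_hom
    by (intro bij_betw_imageI inj_on_inverseI[where g = psi]) (auto simp: hom_def Pi_iff)
  then have "phi \<in> iso ?D ?P"
    by (simp add: iso_def phi_hom)
  then have "?D \<cong> ?P"
    unfolding is_iso_def by blast
  then show ?thesis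
    unfolding kurosh_type_def ms by blast
qed

end

section \<open>Uniqueness of the canonical labelling\<close>

text \<open>
  An isomorphism of pointed actions preserves the course of the search, hence the labels.
\<close>

lemma canonical_involution_unique:
  assumes C1: "canonical_action H q m X" and C2: "canonical_action H q m X'"
    and same: "{g \<in> carrier H. hecke_action.act X (standard_cycle q) g 0 = 0} =
               {g \<in> carrier H. hecke_action.act X' (standard_cycle q) g 0 = 0}"
  shows "X = X'"
proof -
  interpret C1: canonical_action H q m X by (rule C1)
  interpret C2: canonical_action H q m X' by (rule C2)
  have eq_iff: "C1.act g 0 = C1.act h 0 \<longleftrightarrow> C2.act g 0 = C2.act h 0"
    if "g \<in> carrier H" "h \<in> carrier H" for g h
    using C1.inv_mult_in_stab_iff[OF that] C2.inv_mult_in_stab_iff[OF that] same by simp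
  \<comment> \<open>The isomorphism of the two pointed actions; it is shown to be the identity.\<close>
  define f where "f p = C2.act (C1.rep p) 0" for p
  have f_act: "f (C1.act g 0) = C2.act g 0" if "g \<in> carrier H" for g
    using that eq_iff[of "C1.rep (C1.act g 0)" g] C1.act_closed[of g 0]
    by (simp add: f_def C1.rep_closed C1.act_rep)
  have f_less: "f p < q * m" if "p < q * m" for p
    using C2.act_closed[OF C1.rep_closed[OF that], of 0] by (simp add: f_def)
  have f_inj: "p = p'" if "p < q * m" "p' < q * m" "f p = f p'" for p p'
    using that eq_iff[of "C1.rep p" "C1.rep p'"] by (simp add: f_def C1.rep_closed C1.act_rep)
  have f_X: "f (X p) = X' (f p)" if "p < q * m" for p
    using that f_act[of "hecke_x \<otimes>\<^bsub>H\<^esub> C1.rep p"]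
    by (simp add: C1.act_x C2.act_x C1.rep_closed C1.act_rep f_def)
  have f_Y: "f (standard_cycle q p) = standard_cycle q (f p)" if "p < q * m" for p
    using that f_act[of "hecke_y \<otimes>\<^bsub>H\<^esub> C1.rep p"]
    by (simp add: C1.act_y C2.act_y C1.rep_closed C1.act_rep f_def)
  have f_id: "f p = p" if "p < q * m" for p
    using that
  proof (induction p rule: less_induct)
    case (less p)
    consider "p = 0" | p' where "p = Suc p'" "p mod q \<noteq> 0" | "q dvd p" "0 < p"
      by (cases p) auto
    then show ?case
    proof cases
      case 1
      then show ?thesis by (simp add: f_def)
    next
      case 2
      then show ?thesis
        using less f_Y[of p'] C1.standard_cycle_Suc[of p'] by simp
    next
      case 3
      have below: "X' a = f (X a)" if "a < p" for a
        using that less f_X[of a] by simp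
      obtain e where e: "e < p" "X e = p" "\<And>a. a < e \<Longrightarrow> X a < p"
        using C1.X_entry[OF 3 less.prems] by blast
      obtain e' where e': "e' < p" "X' e' = p" "\<And>a. a < e' \<Longrightarrow> X' a < p"
        using C2.X_entry[OF 3 less.prems] by blast
      have "\<not> e' < e"
      proof
        assume "e' < e"
        then have "X e' < p" by (rule e(3))
        then have "f (X e') = X e'" using less by simp
        then show False using below[OF e'(1)] e'(2) \<open>X e' < p\<close> by simp
      qed
      moreover have "\<not> e < e'"
      proof
        assume "e < e'"
        then have fp: "f p < p" using below[OF e(1)] e(2) e'(3)[of e] by simp
        then have "f (f p) = f p" using less by simp
        then show False using f_inj[of "f p" p] fp less.prems by simp
      qed
      ultimately have "e = e'" by simp
      then show ?thesis using below[OF e(1)] e(2) e'(2) by simp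
    qed
  qed
  have "X p = X' p" for p
  proof (cases "p < q * m")
    case True
    then show ?thesis using f_X[of p] f_id C1.X_less_iff by simp
  next
    case False
    moreover have "X permutes {..<q * m}" "X' permutes {..<q * m}"
      using C1.X_canonical C2.X_canonical by (auto simp: canonical_involutions_def)
    ultimately show ?thesis by (simp add: permutes_not_in)
  qed
  then show ?thesis by (rule ext)
qed

section \<open>Breadth-first search of the coset space\<close>

text \<open>
  Breadth-first search of the coset space of a subgroup \<open>D\<close>. The hypothesis \<open>free\<close> says that no
  nontrivial power of \<open>y\<close> fixes a coset, so that each new cycle has exactly \<open>q\<close> points.
\<close>

locale free_subgroup = hecke +
  fixes D :: "(nat \<times> int) list set"
  assumes D: "subgroup D H"
    and free: "g \<in> carrier H \<Longrightarrow> 0 < k \<Longrightarrow> k < q \<Longrightarrow> inv g \<otimes> (hecke_y [^] (k :: nat) \<otimes> g) \<notin> D"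
begin

text \<open>The elements \<open>g\<close> and \<open>h\<close> represent the same left coset of \<open>D\<close>.\<close>

definition same_coset :: "(nat \<times> int) list \<Rightarrow> (nat \<times> int) list \<Rightarrow> bool" (infix "\<approx>" 50) where
  "g \<approx> h \<longleftrightarrow> g \<in> carrier H \<and> h \<in> carrier H \<and> inv g \<otimes> h \<in> D"

lemma same_coset_refl: "g \<in> carrier H \<Longrightarrow> g \<approx> g"
  using subgroup.one_closed[OF D] by (simp add: same_coset_def)

lemma same_coset_sym: "g \<approx> h \<Longrightarrow> h \<approx> g"
  using subgroup.m_inv_closed[OF D, of "inv g \<otimes> h"]
  by (simp add: same_coset_def inv_mult_group)

lemma same_coset_trans: "g \<approx> h \<Longrightarrow> h \<approx> k \<Longrightarrow> g \<approx> k"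
proof -
  assume "g \<approx> h" "h \<approx> k"
  then have *: "g \<in> carrier H" "h \<in> carrier H" "k \<in> carrier H" "inv g \<otimes> h \<otimes> (inv h \<otimes> k) \<in> D"
    using subgroup.m_closed[OF D] by (auto simp: same_coset_def)
  moreover have "inv g \<otimes> h \<otimes> (inv h \<otimes> k) = inv g \<otimes> k"
    using * by (simp add: m_assoc mult_inv_left)
  ultimately show ?thesis by (simp add: same_coset_def)
qed

lemma same_coset_mult: "g \<approx> h \<Longrightarrow> k \<in> carrier H \<Longrightarrow> k \<otimes> g \<approx> k \<otimes> h"
  by (simp add: same_coset_def inv_mult_group m_assoc inv_mult_left)

text \<open>
  \<open>partial_labelling j r\<close> says that \<open>r\<close> is an outcome of the search after \<open>j\<close> cycles: for \<open>p < q * j\<close>,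
  the element \<open>r p\<close> represents the coset with the label \<open>p\<close>.
\<close>

definition partial_labelling :: "nat \<Rightarrow> (nat \<Rightarrow> (nat \<times> int) list) \<Rightarrow> bool" where
  "partial_labelling j r \<longleftrightarrow>
     r 0 = \<one> \<and> (\<forall>p<q * j. r p \<in> carrier H) \<and>
     (\<forall>p<q * j. \<forall>p'<q * j. r p \<approx> r p' \<longrightarrow> p = p') \<and>
     (\<forall>p<q * j. r (standard_cycle q p) \<approx> hecke_y \<otimes> r p) \<and>
     (\<forall>i. 0 < i \<and> i < j \<longrightarrow> (\<exists>e<q * i. r (q * i) \<approx> hecke_x \<otimes> r e \<and>
        (\<forall>p<e. \<exists>p'<q * i. r p' \<approx> hecke_x \<otimes> r p)))"

lemma y_powers_distinct:
  assumes g: "g \<in> carrier H" and i: "i < q" "i' < q"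
    and same: "hecke_y [^] i \<otimes> g \<approx> hecke_y [^] i' \<otimes> g"
  shows "i = i'"
proof -
  have less: "\<not> i < i'" if i': "i' < q" and same: "hecke_y [^] i \<otimes> g \<approx> hecke_y [^] i' \<otimes> g" for i i' :: nat
  proof
    assume "i < i'"
    then have "hecke_y [^] i' = hecke_y [^] i \<otimes> hecke_y [^] (i' - i)"
      by (simp add: nat_pow_mult)
    then have "inv (hecke_y [^] i \<otimes> g) \<otimes> (hecke_y [^] i' \<otimes> g) =
        inv g \<otimes> (hecke_y [^] (i' - i) \<otimes> g)"
      using g by (simp add: inv_mult_group m_assoc inv_mult_left)
    then show False
      using same free[OF g, of "i' - i"] \<open>i < i'\<close> i' by (simp add: same_coset_def)
  qed
  show ?thesis
    using less[OF i(2) same] less[OF i(1) same_coset_sym[OF same]] by simp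
qed

lemma standard_cycle_offset: "i < q \<Longrightarrow> standard_cycle q (q * j + i) = (if Suc i = q then q * j else q * j + Suc i)"
  by (auto simp: standard_cycle_def mod_Suc)

lemma y_pow_standard_cycle:
  assumes "g \<in> carrier H" "i < q"
  shows "hecke_y \<otimes> (hecke_y [^] i \<otimes> g) = hecke_y [^] (if Suc i = q then 0 else Suc i) \<otimes> g"
proof -
  have "hecke_y \<otimes> (hecke_y [^] i \<otimes> g) = hecke_y [^] Suc i \<otimes> g"
    using nat_pow_Suc2[OF y_closed, of i] assms(1) by (simp add: m_assoc)
  then show ?thesis
    using y_pow_q by auto
qed

lemma partial_labelling_one: "partial_labelling 1 (\<lambda>p. hecke_y [^] p)"
proof -
  have "hecke_y [^] standard_cycle q p \<approx> hecke_y \<otimes> hecke_y [^] p" if "p < q" for p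
    using that standard_cycle_offset[of p 0] y_pow_standard_cycle[of \<one> p] same_coset_refl
    by (simp split: if_splits)
  moreover have "p = p'" if "p < q" "p' < q" "hecke_y [^] p \<approx> hecke_y [^] p'" for p p' :: nat
    using that y_powers_distinct[of \<one> p p'] by simp
  ultimately show ?thesis
    by (auto simp: partial_labelling_def)
qed

text \<open>As long as some coset \<open>g D\<close> is not labelled, the search discovers a further cycle.\<close>

lemma partial_labelling_extend:
  assumes r: "partial_labelling j r" and j: "0 < j"
    and g: "g \<in> carrier H" and new: "\<forall>p<q * j. \<not> r p \<approx> g"
  shows "\<exists>r. partial_labelling (Suc j) r"
proof -
  have r0: "r 0 = \<one>" and rc: "\<And>p. p < q * j \<Longrightarrow> r p \<in> carrier H"
    and rinj: "\<And>p p'. p < q * j \<Longrightarrow> p' < q * j \<Longrightarrow> r p \<approx> r p' \<Longrightarrow> p = p'"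
    and rY: "\<And>p. p < q * j \<Longrightarrow> r (standard_cycle q p) \<approx> hecke_y \<otimes> r p"
    and rX: "\<And>i. 0 < i \<Longrightarrow> i < j \<Longrightarrow> \<exists>e<q * i. r (q * i) \<approx> hecke_x \<otimes> r e \<and>
        (\<forall>p<e. \<exists>p'<q * i. r p' \<approx> hecke_x \<otimes> r p)"
    using r unfolding partial_labelling_def by blast+
  have qj: "0 < q * j" using j q_gt_1 by simp
  have Ypow: "\<exists>p'<q * j. r p' \<approx> hecke_y [^] k \<otimes> h"
    if "p < q * j" "r p \<approx> h" for p h and k :: nat
  proof (induction k)
    case 0
    then show ?case using that by (auto simp: same_coset_def)
  next
    case (Suc k)
    then obtain p' where p': "p' < q * j" "r p' \<approx> hecke_y [^] k \<otimes> h" by blast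
    have "r (standard_cycle q p') \<approx> hecke_y \<otimes> (hecke_y [^] k \<otimes> h)"
      using same_coset_trans[OF rY[OF p'(1)] same_coset_mult[OF p'(2) y_closed]] .
    also have "hecke_y \<otimes> (hecke_y [^] k \<otimes> h) = hecke_y [^] Suc k \<otimes> h"
      using nat_pow_Suc2[OF y_closed, of k] that(2) by (simp add: m_assoc same_coset_def)
    finally show ?case using standard_cycle_less[OF p'(1)] by blast
  qed
  \<comment> \<open>The labelled cosets are closed under \<open>y\<close>; since they are not all cosets, \<open>x\<close> leads out of them.\<close>
  have "\<exists>e<q * j. \<forall>p<q * j. \<not> r p \<approx> hecke_x \<otimes> r e"
  proof (rule ccontr)
    assume closed: "\<not> ?thesis"
    have "\<exists>p<q * j. r p \<approx> g"
      using g
    proof (induction rule: hecke_induct)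
      case one
      show ?case using qj r0 same_coset_refl[OF one_closed] by (intro exI[of _ 0]) simp
    next
      case (x g)
      then obtain p p' where "p < q * j" "r p \<approx> g" "p' < q * j" "r p' \<approx> hecke_x \<otimes> r p"
        using closed by blast
      then show ?case
        using same_coset_trans same_coset_mult[OF \<open>r p \<approx> g\<close> x_closed] by blast
    next
      case (y g)
      then show ?case using Ypow[of _ g 1] by auto
    qed
    then show False using new by blast
  qed
  then obtain e where e: "e < q * j" "\<forall>p<q * j. \<not> r p \<approx> hecke_x \<otimes> r e"
    and e_least: "\<And>a. a < e \<Longrightarrow> \<exists>p<q * j. r p \<approx> hecke_x \<otimes> r a"
    using exists_least_iff[of "\<lambda>e. e < q * j \<and> (\<forall>p<q * j. \<not> r p \<approx> hecke_x \<otimes> r e)"]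
    by (meson less_trans)
  define h where "h = hecke_x \<otimes> r e"
  have h: "h \<in> carrier H" using rc[OF e(1)] by (simp add: h_def)
  define r' where "r' p = (if p < q * j then r p else hecke_y [^] (p - q * j) \<otimes> h)" for p
  have old: "r' p = r p" if "p < q * j" for p using that by (simp add: r'_def)
  have new_eq: "r' (q * j + i) = hecke_y [^] i \<otimes> h" for i by (simp add: r'_def)
  have fresh: "\<not> r p \<approx> hecke_y [^] i \<otimes> h" if "p < q * j" "i < q" for p and i :: nat
  proof
    assume "r p \<approx> hecke_y [^] i \<otimes> h"
    from Ypow[OF that(1) this, of "q - i"] obtain p' where p': "p' < q * j"
      "r p' \<approx> hecke_y [^] (q - i) \<otimes> (hecke_y [^] i \<otimes> h)" by blast
    moreover have "hecke_y [^] (q - i) \<otimes> (hecke_y [^] i \<otimes> h) = hecke_y [^] (q - i + i) \<otimes> h"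
      using h by (simp add: nat_pow_mult flip: m_assoc)
    ultimately show False using e(2) that(2) h y_pow_q by (simp add: h_def)
  qed
  have split: "p < q * j \<or> (\<exists>i<q. p = q * j + i)" if "p < q * Suc j" for p
  proof (cases "p < q * j")
    case False
    then have "p - q * j < q" "p = q * j + (p - q * j)" using that by auto
    then show ?thesis by blast
  qed simp
  have "r' 0 = \<one>" using old qj r0 by simp
  moreover have "r' p \<in> carrier H" if "p < q * Suc j" for p
    using split[OF that] rc h by (auto simp: old new_eq)
  moreover have "p = p'" if p: "p < q * Suc j" and p': "p' < q * Suc j" and eq: "r' p \<approx> r' p'" for p p'
  proof -
    consider "p < q * j" "p' < q * j"
      | i where "p < q * j" "i < q" "p' = q * j + i"
      | i where "p' < q * j" "i < q" "p = q * j + i"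
      | i i' where "i < q" "i' < q" "p = q * j + i" "p' = q * j + i'"
      using split[OF p] split[OF p'] by blast
    then show ?thesis
    proof cases
      case 1
      then show ?thesis using rinj eq by (simp add: old)
    next
      case (2 i)
      then show ?thesis using fresh[of p i] eq by (simp add: old new_eq)
    next
      case (3 i)
      then show ?thesis using fresh[of p' i] same_coset_sym[OF eq] by (simp add: old new_eq)
    next
      case (4 i i')
      then show ?thesis using y_powers_distinct[OF h, of i i'] eq by (simp add: new_eq)
    qed
  qed
  moreover have "r' (standard_cycle q p) \<approx> hecke_y \<otimes> r' p" if "p < q * Suc j" for p
    using split[OF that]
  proof
    assume "p < q * j"
    then show ?thesis using rY[of p] standard_cycle_less[of p q j] by (simp add: old)
  next
    assume "\<exists>i<q. p = q * j + i"
    then obtain i where i: "i < q" "p = q * j + i" by blast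
    have "standard_cycle q p = q * j + (if Suc i = q then 0 else Suc i)"
      using i standard_cycle_offset[of i j] by simp
    then have "hecke_y \<otimes> r' p = r' (standard_cycle q p)"
      using i(2) y_pow_standard_cycle[OF h i(1)] by (simp only: new_eq)
    moreover have "hecke_y \<otimes> r' p \<in> carrier H"
      using i h by (simp add: new_eq)
    ultimately show ?thesis
      using same_coset_refl[of "hecke_y \<otimes> r' p"] by simp
  qed
  moreover have "\<exists>e<q * i. r' (q * i) \<approx> hecke_x \<otimes> r' e \<and> (\<forall>p<e. \<exists>p'<q * i. r' p' \<approx> hecke_x \<otimes> r' p)"
    if i: "0 < i" "i < Suc j" for i
  proof (cases "i = j")
    case True
    have "r' (q * j) \<approx> hecke_x \<otimes> r' e"
      using new_eq[of 0] h old[OF e(1)] same_coset_refl by (simp add: h_def)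
    moreover have "\<exists>p'<q * j. r' p' \<approx> hecke_x \<otimes> r' p" if "p < e" for p
      using e_least[OF that] old that e(1) by auto
    ultimately show ?thesis using True e(1) by blast
  next
    case False
    then have ij: "i < j" using i by simp
    then have qij: "q * i < q * j" using q_gt_1 by simp
    obtain e where e: "e < q * i" "r (q * i) \<approx> hecke_x \<otimes> r e"
      "\<forall>p<e. \<exists>p'<q * i. r p' \<approx> hecke_x \<otimes> r p"
      using rX[OF i(1) ij] by blast
    have "r' (q * i) \<approx> hecke_x \<otimes> r' e"
      using e(2) old[OF less_trans[OF e(1) qij]] old[OF qij] by simp
    moreover have "\<exists>p'<q * i. r' p' \<approx> hecke_x \<otimes> r' p" if p: "p < e" for p
    proof -
      obtain p' where "p' < q * i" "r p' \<approx> hecke_x \<otimes> r p" using e(3) p by blast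
      then show ?thesis
        using old[OF less_trans[OF _ qij], of p'] old[OF less_trans[OF less_trans[OF p e(1)] qij]]
        by auto
    qed
    ultimately show ?thesis using e(1) by blast
  qed
  ultimately show ?thesis
    unfolding partial_labelling_def by blast
qed

lemma complete_labelling:
  assumes fin: "finite (rcosets D)"
  shows "\<exists>j r. 0 < j \<and> partial_labelling j r \<and> (\<forall>g\<in>carrier H. \<exists>p<q * j. r p \<approx> g)"
proof (rule ccontr)
  assume no: "\<not> ?thesis"
  \<comment> \<open>Otherwise the search does not end, and labels more cosets than there are.\<close>
  have "\<exists>r. partial_labelling (Suc j) r" for j
  proof (induction j)
    case 0
    then show ?case using partial_labelling_one by auto
  next
    case (Suc j)
    then obtain r where r: "partial_labelling (Suc j) r" by blast
    with no have "\<not> (\<forall>g\<in>carrier H. \<exists>p<q * Suc j. r p \<approx> g)" by blast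
    then obtain g where "g \<in> carrier H" "\<forall>p<q * Suc j. \<not> r p \<approx> g" by blast
    then show ?case using partial_labelling_extend[OF r] by blast
  qed
  then obtain r where r: "partial_labelling (Suc (card (rcosets D))) r" by blast
  let ?N = "q * Suc (card (rcosets D))"
  have rc: "r p \<in> carrier H" if "p < ?N" for p
    using r that unfolding partial_labelling_def by blast
  have "inj_on (\<lambda>p. D #> inv (r p)) {..<?N}"
  proof (rule inj_onI)
    fix p p' assume p: "p \<in> {..<?N}" "p' \<in> {..<?N}" and "D #> inv (r p) = D #> inv (r p')"
    then have "r p \<approx> r p'"
      using rcos_inv_eq_iff[OF D, of "r p" "r p'"] rc by (auto simp: same_coset_def)
    then show "p = p'" using r p unfolding partial_labelling_def by blast
  qed
  then have "card {..<?N} \<le> card (rcosets D)"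
    using rc rcosetsI[OF subgroup.subset[OF D]] by (intro card_inj_on_le fin) auto
  then have "q * Suc (card (rcosets D)) \<le> card (rcosets D)" by simp
  moreover have "1 * Suc (card (rcosets D)) \<le> q * Suc (card (rcosets D))"
    using q_gt_1 by (intro mult_le_mono1) simp
  ultimately show False by simp
qed

theorem canonical_involution_exists:
  assumes fin: "finite (rcosets D)"
  shows "\<exists>m X. 0 < m \<and> card (rcosets D) = q * m \<and> X \<in> canonical_involutions q (q * m) \<and>
           D = {g \<in> carrier H. hecke_action.act X (standard_cycle q) g 0 = 0}"
proof -
  obtain m r where m: "0 < m" and r: "partial_labelling m r"
    and total: "\<forall>g\<in>carrier H. \<exists>p<q * m. r p \<approx> g"
    using complete_labelling[OF fin] by blast
  have r0: "r 0 = \<one>" and rc: "\<And>p. p < q * m \<Longrightarrow> r p \<in> carrier H"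
    and rinj: "\<And>p p'. p < q * m \<Longrightarrow> p' < q * m \<Longrightarrow> r p \<approx> r p' \<Longrightarrow> p = p'"
    and rY: "\<And>p. p < q * m \<Longrightarrow> r (standard_cycle q p) \<approx> hecke_y \<otimes> r p"
    and rX: "\<And>i. 0 < i \<Longrightarrow> i < m \<Longrightarrow> \<exists>e<q * i. r (q * i) \<approx> hecke_x \<otimes> r e \<and>
        (\<forall>p<e. \<exists>p'<q * i. r p' \<approx> hecke_x \<otimes> r p)"
    using r unfolding partial_labelling_def by blast+
  have "bij_betw (\<lambda>p. D #> inv (r p)) {..<q * m} (rcosets D)"
  proof (rule bij_betw_transversal_rcosets[OF D])
    fix g assume g: "g \<in> carrier H"
    then obtain p where p: "p < q * m" "r p \<approx> g" using total by blast
    then show "\<exists>p\<in>{..<q * m}. inv g \<otimes> r p \<in> D"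
      using same_coset_sym[OF p(2)] by (auto simp: same_coset_def)
  qed (use rc rinj in \<open>auto simp: same_coset_def\<close>)
  then have index: "card (rcosets D) = q * m"
    using bij_betw_same_card by fastforce
  define X where "X p = (if p < q * m then SOME p'. p' < q * m \<and> r p' \<approx> hecke_x \<otimes> r p else p)" for p
  have X: "X p < q * m \<and> r (X p) \<approx> hecke_x \<otimes> r p" if p: "p < q * m" for p
  proof -
    have "\<exists>p'. p' < q * m \<and> r p' \<approx> hecke_x \<otimes> r p"
      using total rc[OF p] by simp
    from someI_ex[OF this] show ?thesis using p by (simp add: X_def)
  qed
  have X_eq: "X p = p'" if "p < q * m" "p' < q * m" "r p' \<approx> hecke_x \<otimes> r p" for p p'
    using X[OF that(1)] that rinj[of "X p" p'] same_coset_trans same_coset_sym by blast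
  have X_X: "X (X p) = p" for p
  proof (cases "p < q * m")
    case True
    have "hecke_x \<otimes> r (X p) \<approx> r p"
      using same_coset_mult[OF conjunct2[OF X[OF True]] x_closed] rc[OF True] by (simp add: x_x_left)
    then show ?thesis
      using X_eq[of "X p" p] X[OF True] True same_coset_sym by blast
  qed (simp add: X_def)
  have "X permutes {..<q * m}"
    unfolding permutes_def using X_X by (metis X_def lessThan_iff)
  moreover have "X \<circ> X = id"
    using X_X by auto
  moreover have "\<exists>e<q * i. X e = q * i \<and> (\<forall>p<e. X p < q * i)" if i: "0 < i" "q * i < q * m" for i
  proof -
    have "i < m" using i by simp
    from rX[OF i(1) this] obtain e where e: "e < q * i" "r (q * i) \<approx> hecke_x \<otimes> r e"
      "\<forall>p<e. \<exists>p'<q * i. r p' \<approx> hecke_x \<otimes> r p" by blast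
    have "X e = q * i" by (rule X_eq[OF less_trans[OF e(1) i(2)] i(2) e(2)])
    moreover have "X p < q * i" if p: "p < e" for p
    proof -
      obtain p' where "p' < q * i" "r p' \<approx> hecke_x \<otimes> r p" using e(3) p by blast
      then show ?thesis using X_eq[of p p'] p e(1) i(2) by simp
    qed
    ultimately show ?thesis using e(1) by blast
  qed
  ultimately have can: "X \<in> canonical_involutions q (q * m)"
    by (simp add: canonical_involutions_def)
  interpret C: canonical_action H q m X
    by unfold_locales (use m can in auto)
  have r_act: "r (C.act g 0) \<approx> g" if "g \<in> carrier H" for g
    using that
  proof (induction rule: hecke_induct)
    case one
    show ?case using r0 same_coset_refl by simp
  next
    case (x g)
    then have "C.act g 0 < q * m" using C.act_closed[of g 0] by simp
    then show ?case
      using x X same_coset_trans same_coset_mult[OF x(2) x_closed] by (simp add: C.act_x) blast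
  next
    case (y g)
    then have "C.act g 0 < q * m" using C.act_closed[of g 0] by simp
    then show ?case
      using y rY same_coset_trans same_coset_mult[OF y(2) y_closed] by (simp add: C.act_y) blast
  qed
  have "g \<in> D \<longleftrightarrow> C.act g 0 = 0" if g: "g \<in> carrier H" for g
  proof -
    have "g \<in> D \<longleftrightarrow> r 0 \<approx> g" using g by (simp add: r0 same_coset_def)
    also have "\<dots> \<longleftrightarrow> r 0 \<approx> r (C.act g 0)"
      using r_act[OF g] same_coset_trans same_coset_sym by blast
    also have "\<dots> \<longleftrightarrow> C.act g 0 = 0"
      using rinj[of 0 "C.act g 0"] C.act_closed[OF g, of 0] r0 same_coset_refl[OF one_closed] by auto
    finally show ?thesis .
  qed
  then have "D = C.stab" using subgroup.subset[OF D] by auto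
  then show ?thesis using m index can by blast
qed

end

section \<open>Subgroups correspond to canonical involutions\<close>

text \<open>
  For odd \<open>q\<close>, a free product of copies of \<open>C\<^sub>2\<close> and \<open>C\<^sub>\<infinity>\<close> has no nontrivial element of an order
  dividing \<open>q\<close>, so a subgroup with \<open>\<mu> = 0\<close> contains no conjugate of a nontrivial power of \<open>y\<close>.
\<close>

lemma (in hecke) free_subgroup_of_kurosh_type:
  assumes D: "subgroup D H" and q: "odd q" and type: "kurosh_type q (H\<lparr>carrier := D\<rparr>) l 0 v"
  shows "free_subgroup H q D"
proof (rule free_subgroup.intro[OF hecke_axioms free_subgroup_axioms.intro[OF D]])
  fix g and k :: nat assume g: "g \<in> carrier H" and k: "0 < k" "k < q"
  define t where "t = inv g \<otimes> (hecke_y [^] k \<otimes> g)"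
  let ?ms = "replicate l 2 @ replicate 0 q @ replicate v 0"
  let ?P = "free_product_cyclic ?ms" and ?D = "H\<lparr>carrier := D\<rparr>"
  interpret P: group ?P by simp
  obtain f where f: "f \<in> iso ?D ?P"
    using type by (auto simp: kurosh_type_def is_iso_def)
  interpret f: group_hom ?D ?P f
    using f subgroup.subgroup_is_group[OF D is_group]
    by (simp add: group_hom_def group_hom_axioms_def iso_def)
  have t: "t \<in> carrier H" using g by (simp add: t_def)
  have t_pow: "t [^] n = inv g \<otimes> (hecke_y [^] (k * n) \<otimes> g)" for n :: nat
  proof (induction n)
    case (Suc n)
    have "t [^] Suc n = inv g \<otimes> (hecke_y [^] (k * n) \<otimes> (g \<otimes> (inv g \<otimes> (hecke_y [^] k \<otimes> g))))"
      using g Suc by (simp add: t_def m_assoc)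
    also have "\<dots> = inv g \<otimes> (hecke_y [^] (k * n) \<otimes> hecke_y [^] k \<otimes> g)"
      using g by (simp add: mult_inv_left m_assoc)
    also have "hecke_y [^] (k * n) \<otimes> hecke_y [^] k = hecke_y [^] (k * Suc n)"
      by (simp add: nat_pow_mult add.commute)
    finally show ?case .
  qed (use g in simp)
  have "hecke_y [^] (k * q) = \<one>"
    using y_pow_q by (simp add: mult.commute[of k] flip: nat_pow_pow)
  then have t_q: "t [^] q = \<one>"
    using g by (simp add: t_pow)
  show "inv g \<otimes> (hecke_y [^] k \<otimes> g) \<notin> D"
  proof
    assume "inv g \<otimes> (hecke_y [^] k \<otimes> g) \<in> D"
    then have tD: "t \<in> carrier ?D" by (simp add: t_def)
    have "f t [^]\<^bsub>?P\<^esub> q = f (t [^]\<^bsub>?D\<^esub> q)"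
      using f.hom_nat_pow[OF tD] by simp
    also have "t [^]\<^bsub>?D\<^esub> q = \<one>\<^bsub>?D\<^esub>"
      using t_q by (simp flip: nat_pow_consistent)
    finally have "f t [^]\<^bsub>?P\<^esub> q = []" using f.hom_one by simp
    moreover have "?ms ! i = 0 \<or> coprime (?ms ! i) q" if "i < length ?ms" for i
      using that q by (auto simp: nth_append)
    ultimately have "f t = []"
      using torsion_free_product_cyclic[of ?ms q "f t"] f.hom_closed[OF tD] q_gt_1 by auto
    then have "f t = f \<one>\<^bsub>?D\<^esub>" using f.hom_one by simp
    then have "t = \<one>"
      using f tD subgroup.one_closed[OF D] by (auto simp: iso_def bij_betw_def dest: inj_onD)
    then have "g \<otimes> t = g" using g by simp
    then have "hecke_y [^] k \<otimes> g = g"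
      using g by (simp add: t_def mult_inv_left)
    then have "hecke_y [^] k = \<one>"
      using g by (simp add: r_cancel_one')
    then show False using y_pow_noncancel[OF k] by simp
  qed
qed

lemma (in hecke) bij_betw_canonical_involutions:
  assumes q: "odd q" and m: "0 < m"
  shows "bij_betw (\<lambda>X. {g \<in> carrier H. hecke_action.act X (standard_cycle q) g 0 = 0})
           (canonical_involutions q (q * m))
           {D. subgroup D H \<and> card (rcosets D) = q * m \<and> (\<exists>l v. kurosh_type q (H\<lparr>carrier := D\<rparr>) l 0 v)}"
    (is "bij_betw ?stab ?A ?B")
proof (rule bij_betwI')
  have can: "canonical_action H q m X" if "X \<in> ?A" for X
    by unfold_locales (use that m in auto)
  show "(?stab X = ?stab X') = (X = X')" if "X \<in> ?A" "X' \<in> ?A" for X X'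
    using canonical_involution_unique[OF can[OF that(1)] can[OF that(2)]] by blast
  show "?stab X \<in> ?B" if "X \<in> ?A" for X
  proof -
    interpret canonical_action H q m X by (rule can[OF that])
    show ?thesis using subgroup_stab index_stab kurosh_type_stab by simp
  qed
  show "\<exists>X\<in>?A. D = ?stab X" if "D \<in> ?B" for D
  proof -
    from that obtain l v where sub: "subgroup D H" and index: "card (rcosets D) = q * m"
      and type: "kurosh_type q (H\<lparr>carrier := D\<rparr>) l 0 v" by blast
    interpret free_subgroup H q D
      by (rule free_subgroup_of_kurosh_type[OF sub q type])
    have "card (rcosets D) > 0" using index m q_gt_1 by simp
    then have "finite (rcosets D)" using card_gt_0_iff by blast
    then obtain m' X where "card (rcosets D) = q * m'" "X \<in> canonical_involutions q (q * m')" "D = ?stab X"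
      using canonical_involution_exists by blast
    moreover from this have "m' = m" using index q_gt_1 by simp
    ultimately show ?thesis by blast
  qed
qed

section \<open>Parity of the number of canonical involutions\<close>

lemma even_card_of_involution:
  assumes "finite A" and "\<And>a. a \<in> A \<Longrightarrow> f a \<in> A" "\<And>a. a \<in> A \<Longrightarrow> f (f a) = a" "\<And>a. a \<in> A \<Longrightarrow> f a \<noteq> a"
  shows "even (card A)"
proof -
  have "even (card (\<Union>a\<in>A. {a, f a}))"
  proof (rule dvd_partition)
    show "finite (\<Union>a\<in>A. {a, f a})" using assms(1) by auto
    show "\<forall>c\<in>(\<lambda>a. {a, f a}) ` A. even (card c)"
      using assms(4) by (fastforce simp: card_insert_if)
    show "\<forall>c1\<in>(\<lambda>a. {a, f a}) ` A. \<forall>c2\<in>(\<lambda>a. {a, f a}) ` A. c1 \<noteq> c2 \<longrightarrow> c1 \<inter> c2 = {}"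
    proof -
      have "{a, f a} = {z, f z}" if "a \<in> A" "z \<in> {a, f a}" for a z
        using that assms(3)[of a] by auto
      then show ?thesis by blast
    qed
  qed
  moreover have "(\<Union>a\<in>A. {a, f a}) = A" using assms(2) by auto
  ultimately show ?thesis by simp
qed

text \<open>
  The points \<open>s\<close> and \<open>t\<close> of the proof lie on the cycle that is discovered last and are not its entry,
  so the search does not reach them before all cycles are known. Hence multiplication of a canonical
  involution by the transposition \<open>\<tau>\<close> of \<open>s\<close> and \<open>t\<close>, or conjugation with \<open>\<tau>\<close>, leads to a canonical
  involution again. The product with \<open>\<tau>\<close> is an involution if the two commute, and otherwise the
  conjugate differs from the involution.
\<close>

lemma even_card_canonical_involutions:
  assumes q: "3 \<le> q" and m: "0 < m"
  shows "even (card (canonical_involutions q (q * m)))"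
proof -
  define s where "s = q * (m - 1) + 1"
  define t where "t = q * (m - 1) + 2"
  define \<tau> where "\<tau> = transpose s t"
  define f where "f X = (if X \<circ> \<tau> = \<tau> \<circ> X then X \<circ> \<tau> else \<tau> \<circ> X \<circ> \<tau>)" for X
  have "q * m = q * (m - 1) + q" using m by (cases m) auto
  then have st: "s < q * m" "t < q * m" "s \<noteq> t" using q by (auto simp: s_def t_def)
  have \<tau>\<tau>: "\<tau> \<circ> \<tau> = id" and \<tau>_perm: "\<tau> permutes {..<q * m}" and \<tau>_id: "\<tau> \<noteq> id"
    using st by (auto simp: \<tau>_def permutes_swap_id fun_eq_iff transpose_def)
  have \<tau>_fix: "\<tau> p = p" if "p \<le> q * (m - 1)" for p
    using that by (simp add: \<tau>_def s_def t_def transpose_def)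
  have \<tau>\<tau>': "\<tau> (\<tau> p) = p" for p using \<tau>\<tau> by (simp add: fun_eq_iff)
  show ?thesis
  proof (rule even_card_of_involution[where f = f])
    show "finite (canonical_involutions q (q * m))"
      by (rule finite_subset[OF _ finite_permutations[of "{..<q * m}"]])
         (auto simp: canonical_involutions_def)
  next
    fix X assume X: "X \<in> canonical_involutions q (q * m)"
    then have perm: "X permutes {..<q * m}" and XX: "X \<circ> X = id"
      and can: "\<And>j. 0 < j \<Longrightarrow> q * j < q * m \<Longrightarrow> \<exists>e<q * j. X e = q * j \<and> (\<forall>p<e. X p < q * j)"
      unfolding canonical_involutions_def by blast+
    \<comment> \<open>Both cases of the definition of \<open>f\<close> are preserved by \<open>f\<close>.\<close>
    have comm_conj: "(\<tau> \<circ> X \<circ> \<tau>) \<circ> \<tau> = \<tau> \<circ> (\<tau> \<circ> X \<circ> \<tau>) \<longleftrightarrow> X \<circ> \<tau> = \<tau> \<circ> X"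
      using \<tau>\<tau>' by (simp add: fun_eq_iff) metis
    show "f (f X) = X"
      using comm_conj \<tau>\<tau>' by (auto simp: f_def fun_eq_iff)
    show "f X \<noteq> X"
    proof
      assume fX: "f X = X"
      show False
      proof (cases "X \<circ> \<tau> = \<tau> \<circ> X")
        case True
        then have "X \<circ> \<tau> = X" using fX by (simp add: f_def)
        then have "X \<circ> X \<circ> \<tau> = X \<circ> X" by (simp add: comp_assoc)
        then show False using XX \<tau>_id by simp
      next
        case False
        then have "\<tau> \<circ> X \<circ> \<tau> = X" using fX by (simp add: f_def)
        then have "\<tau> \<circ> (\<tau> \<circ> X \<circ> \<tau>) = \<tau> \<circ> X" by simp
        then have "X \<circ> \<tau> = \<tau> \<circ> X" using \<tau>\<tau> by (simp flip: comp_assoc)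
        then show False using False by simp
      qed
    qed
    \<comment> \<open>The values that the canonicity conditions inspect are not affected.\<close>
    have low: "f X p = X p" if "p \<le> q * (m - 1)" "X p \<le> q * (m - 1)" for p
      using that by (simp add: f_def \<tau>_fix)
    have "f X permutes {..<q * m}"
      using perm \<tau>_perm by (auto simp: f_def intro: permutes_compose)
    moreover have "f X \<circ> f X = id"
    proof (cases "X \<circ> \<tau> = \<tau> \<circ> X")
      case True
      have "(X \<circ> \<tau>) \<circ> (X \<circ> \<tau>) = (X \<circ> \<tau>) \<circ> (\<tau> \<circ> X)" by (simp only: True)
      also have "\<dots> = id" using XX \<tau>\<tau>' by (simp add: fun_eq_iff)
      finally show ?thesis using True by (simp add: f_def)
    next
      case False
      then show ?thesis using XX \<tau>\<tau>' by (simp add: f_def fun_eq_iff)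
    qed
    moreover have "\<exists>e<q * j. f X e = q * j \<and> (\<forall>p<e. f X p < q * j)" if j: "0 < j" "q * j < q * m" for j
    proof -
      have "j \<le> m - 1" using j(2) by auto
      then have le: "q * j \<le> q * (m - 1)" by simp
      obtain e where e: "e < q * j" "X e = q * j" "\<forall>p<e. X p < q * j" using can[OF j] by blast
      have "f X e = q * j"
        using low[of e] e(1,2) le by linarith
      moreover have "f X p < q * j" if p: "p < e" for p
      proof -
        have "X p < q * j" using e(3) p by blast
        then show ?thesis using low[of p] p e(1) le by linarith
      qed
      ultimately show ?thesis using e(1) by blast
    qed
    ultimately show "f X \<in> canonical_involutions q (q * m)"
      by (simp add: canonical_involutions_def)
  qed
qed

theorem theorem16:
  fixes q n :: nat
  assumes "prime q" and "odd q" and "n \<ge> 1"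
  shows "even (num_mu_zero_subgroups q n)"
proof -
  have q: "3 \<le> q"
    using assms(1,2) prime_ge_2_nat[of q] by (cases "q = 2") auto
  interpret hecke "hecke_group q" q
    by (rule hecke_hecke_group) (use q in simp)
  let ?B = "\<lambda>n. {D. subgroup D (hecke_group q) \<and> card (rcosets\<^bsub>hecke_group q\<^esub> D) = n \<and>
           (\<exists>l v. kurosh_type q ((hecke_group q)\<lparr>carrier := D\<rparr>) l 0 v)}"
  show ?thesis
  proof (cases "?B n = {}")
    case True
    then show ?thesis by (simp only: num_mu_zero_subgroups_def card.empty) simp
  next
    case False
    then obtain D l v where sub: "subgroup D (hecke_group q)" and index: "card (rcosets\<^bsub>hecke_group q\<^esub> D) = n"
      and type: "kurosh_type q ((hecke_group q)\<lparr>carrier := D\<rparr>) l 0 v" by blast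
    interpret free_subgroup "hecke_group q" q D
      by (rule free_subgroup_of_kurosh_type[OF sub assms(2) type])
    have "finite (rcosets\<^bsub>hecke_group q\<^esub> D)"
      using index assms(3) card_gt_0_iff[of "rcosets\<^bsub>hecke_group q\<^esub> D"] by simp
    then obtain m where m: "0 < m" "n = q * m"
      using canonical_involution_exists index by auto
    have "card (canonical_involutions q (q * m)) = card (?B (q * m))"
      by (rule bij_betw_same_card[OF bij_betw_canonical_involutions[OF assms(2) m(1)]])
    then show ?thesis
      using even_card_canonical_involutions[OF q m(1)] m(2) by (simp add: num_mu_zero_subgroups_def)
  qed
qed

end
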